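(* The maximal possible number of $2$-dimensional subspaces $Y$ with $\lambda(Y, X) = \frac{4}{3}$ that a real $3$-dimensional normed space $X$ can have is equal to $4$. That is, every real $3$-dimensional normed space $X$ has at most $4$ two-dimensional subspaces $Y \subset X$ with $\lambda(Y,X) = \frac{4}{3}$, and there exists a real $3$-dimensional normed space having exactly $4$ such subspaces.
   Context: All normed spaces are real. For a subspace $Y$ of a normed space $X$, a projection from $X$ onto $Y$ is a bounded linear operator $P: X \to Y$ with $P|_Y = \mathrm{Id}_Y$; the relative projection constant $\lambda(Y,X)$ is the infimum of $\|P\|$ over all projections $P$ from $X$ onto $Y$. *)

theory Defs
  imports "HOL-Analysis.Analysis"
begin

text \<open>
  The norm is an explicit function on a real vector space (type class \<^class>\<open>real_vector\<close>),
  not the class operation \<^const>\<open>norm\<close>, because the existence of a normed space has to be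
  asserted inside a formula and one cannot quantify existentially over types.
\<close>

definition is_norm :: "('a::real_vector \<Rightarrow> real) \<Rightarrow> bool" where
  "is_norm N \<longleftrightarrow>
     (\<forall>x. 0 \<le> N x) \<and>
     (\<forall>x. N x = 0 \<longleftrightarrow> x = 0) \<and>
     (\<forall>c x. N (c *\<^sub>R x) = \<bar>c\<bar> * N x) \<and>
     (\<forall>x y. N (x + y) \<le> N x + N y)"

lemma is_norm_norm: "is_norm (norm :: 'a::real_normed_vector \<Rightarrow> real)"
  by (auto simp: is_norm_def norm_triangle_ineq)

definition bounded_linear_wrt :: "('a::real_vector \<Rightarrow> real) \<Rightarrow> ('a \<Rightarrow> 'a) \<Rightarrow> bool" where
  "bounded_linear_wrt N P \<longleftrightarrow> linear P \<and> (\<exists>K. \<forall>x. N (P x) \<le> N x * K)"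

lemma bounded_linear_wrt_norm:
  "bounded_linear_wrt norm P \<longleftrightarrow> bounded_linear (P :: 'a::real_normed_vector \<Rightarrow> 'a)"
  by (auto simp: bounded_linear_wrt_def bounded_linear_def bounded_linear_axioms_def)

text \<open>As in \<^const>\<open>onorm\<close>, the point 0 contributes 0 / 0 = 0 to the supremum.\<close>

definition onorm_wrt :: "('a::real_vector \<Rightarrow> real) \<Rightarrow> ('a \<Rightarrow> 'a) \<Rightarrow> real" where
  "onorm_wrt N P = (SUP x. N (P x) / N x)"

lemma onorm_wrt_norm: "onorm_wrt norm P = onorm (P :: 'a::real_normed_vector \<Rightarrow> 'a)"
  by (simp add: onorm_wrt_def onorm_def)

text \<open>
  An operator from X to Y is represented as a map on the whole space X (the type) with
  range contained in the subspace Y, which carries the restricted norm.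
\<close>

definition projection_onto :: "('a::real_vector \<Rightarrow> real) \<Rightarrow> 'a set \<Rightarrow> ('a \<Rightarrow> 'a) \<Rightarrow> bool" where
  "projection_onto N Y P \<longleftrightarrow>
     bounded_linear_wrt N P \<and> range P \<subseteq> Y \<and> (\<forall>y\<in>Y. P y = y)"

definition rel_proj_const :: "('a::real_vector \<Rightarrow> real) \<Rightarrow> 'a set \<Rightarrow> real" where
  "rel_proj_const N Y = (INF P\<in>{P. projection_onto N Y P}. onorm_wrt N P)"

definition planes_43 :: "('a::real_vector \<Rightarrow> real) \<Rightarrow> 'a set set" where
  "planes_43 N = {Y. subspace Y \<and> dim Y = 2 \<and> rel_proj_const N Y = 4 / 3}"

end

theory Submission
  imports Defs
begin

text \<open>
  By convex duality, a plane Y of a three-dimensional space has relative projection constant at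
  least 4/3 only if there are three pairs of a point and a functional in the respective unit
  balls that certify it (lemma norming_pairs_exist). Analysing the case of equality in
  Bohnenblust's inequality (lemma bohnenblust_equality) shows that these pairs are rigid: there
  are points x i in the unit ball and functionals g i of norm 1 with g i (x i) = 1 and
  g i (x j) = -1 for distinct i and j, and Y is the kernel of g 1 + g 2 + g 3
  (lemma extremal_system_exists).

  A single such system already determines most of the ball. In the basis x the ball contains the
  octahedron with vertices \<plusminus>x i and is contained in the parallelepiped cut out by the g i, and
  these two bodies differ only in the positive octant and in its opposite. A second system
  consists of three functionals supporting the ball along two-dimensional faces, and a face
  that is not on one of the six \<plusminus>g i lies in one of those two octants (lemma
  contact_trichotomy). The sign pattern allows at most one face of the latter type. So a second
  system shares two functionals, up to sign, with the first one, and the ball then determines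
  the third one (lemma plane_of_other_system). Hence there is at most one further plane for each
  of the three pairs of indices, and at most four planes altogether.

  The space with the l1 norm attains this bound: each of the four planes given by
  \<plusminus>y 1 \<plusminus> y 2 \<plusminus> y 3 = 0 has constant exactly 4/3.
\<close>

section \<open>Norms given as functions\<close>

lemma is_norm_ge0: "is_norm N \<Longrightarrow> 0 \<le> N x"
  and is_norm_eq0: "is_norm N \<Longrightarrow> N x = 0 \<longleftrightarrow> x = 0"
  and is_norm_scaleR: "is_norm N \<Longrightarrow> N (c *\<^sub>R x) = \<bar>c\<bar> * N x"
  and is_norm_triangle: "is_norm N \<Longrightarrow> N (x + y) \<le> N x + N y"
  by (auto simp: is_norm_def)

lemma is_norm_minus: "is_norm N \<Longrightarrow> N (- x) = N x"
  using is_norm_scaleR[of N "-1" x] by simp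

lemma is_norm_convex:
  assumes N: "is_norm N"
  shows "convex_on UNIV N"
proof (rule convex_onI)
  fix t :: real and x y
  assume "0 < t" "t < 1"
  then show "N ((1 - t) *\<^sub>R x + t *\<^sub>R y) \<le> (1 - t) * N x + t * N y"
    using is_norm_triangle[OF N, of "(1 - t) *\<^sub>R x" "t *\<^sub>R y"] by (simp add: is_norm_scaleR[OF N])
qed simp

lemma is_norm_continuous:
  fixes N :: "'a::euclidean_space \<Rightarrow> real"
  shows "is_norm N \<Longrightarrow> continuous_on UNIV N"
  by (simp add: convex_on_continuous is_norm_convex)

lemma is_norm_equivalent:
  fixes N :: "'a::euclidean_space \<Rightarrow> real"
  assumes N: "is_norm N"
  obtains m M where "m > 0" "\<And>x. m * norm x \<le> N x" "\<And>x. N x \<le> M * norm x"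
proof -
  have cont: "continuous_on (sphere 0 1) N"
    using is_norm_continuous[OF N] continuous_on_subset by blast
  have ne: "sphere (0::'a) 1 \<noteq> {}" by simp
  obtain u where u: "u \<in> sphere 0 1" "\<forall>x\<in>sphere 0 1. N u \<le> N x"
    using continuous_attains_inf[OF compact_sphere ne cont] by blast
  obtain v where v: "v \<in> sphere 0 1" "\<forall>x\<in>sphere 0 1. N x \<le> N v"
    using continuous_attains_sup[OF compact_sphere ne cont] by blast
  have "u \<noteq> 0" using u(1) by auto
  then have "N u > 0"
    using is_norm_eq0[OF N, of u] is_norm_ge0[OF N, of u] by linarith
  moreover have "N u * norm x \<le> N x \<and> N x \<le> N v * norm x" for x
  proof (cases "x = 0")
    case True then show ?thesis using is_norm_eq0[OF N, of 0] by simp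
  next
    case False
    define e where "e = (1 / norm x) *\<^sub>R x"
    have "e \<in> sphere 0 1" using False by (simp add: e_def)
    then have "N u \<le> N e" "N e \<le> N v" using u v by auto
    moreover have "N x = norm x * N e"
      using False by (simp add: e_def is_norm_scaleR[OF N])
    ultimately show ?thesis
      by (metis mult.commute mult_left_mono norm_ge_zero)
  qed
  ultimately show ?thesis using that[of "N u" "N v"] by blast
qed

lemma compact_unit_ball:
  fixes N :: "'a::euclidean_space \<Rightarrow> real"
  assumes N: "is_norm N"
  shows "compact {x. N x \<le> 1}"
proof -
  obtain m M where m: "m > 0" "\<And>x. m * norm x \<le> N x"
    using is_norm_equivalent[OF N] by metis
  have "norm x \<le> 1 / m" if "N x \<le> 1" for x
    using m(2)[of x] that m(1) by (simp add: field_simps)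
  then have "bounded {x. N x \<le> 1}" by (auto simp: bounded_iff)
  moreover have "closed {x. N x \<le> 1}"
    by (intro closed_Collect_le is_norm_continuous[OF N] continuous_on_const)
  ultimately show ?thesis by (simp add: compact_eq_bounded_closed)
qed

definition dual_ball :: "('a::euclidean_space \<Rightarrow> real) \<Rightarrow> 'a set" where
  "dual_ball N = {g. \<forall>x. g \<bullet> x \<le> N x}"

lemma compact_dual_ball:
  fixes N :: "'a::euclidean_space \<Rightarrow> real"
  assumes N: "is_norm N"
  shows "compact (dual_ball N)"
proof -
  obtain m M where M: "\<And>x. N x \<le> M * norm x"
    using is_norm_equivalent[OF N] by metis
  have "norm g \<le> M" if "g \<in> dual_ball N" for g
  proof (cases "g = 0")
    case True
    have "0 \<le> M * norm (SOME b::'a. b \<in> Basis)"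
      using M is_norm_ge0[OF N] order_trans by blast
    then show ?thesis using True by (simp add: SOME_Basis)
  next
    case False
    have "norm g * norm g \<le> M * norm g"
      using that M[of g] unfolding dual_ball_def
      by (metis (mono_tags, lifting) mem_Collect_eq order_trans power2_eq_square power2_norm_eq_inner)
    then show ?thesis using False by simp
  qed
  then have "bounded (dual_ball N)" by (auto simp: bounded_iff)
  moreover have "closed (dual_ball N)"
  proof -
    have "dual_ball N = (\<Inter>x. {g. g \<bullet> x \<le> N x})" by (auto simp: dual_ball_def)
    then show ?thesis by (auto intro!: closed_INT closed_Collect_le continuous_intros)
  qed
  ultimately show ?thesis by (simp add: compact_eq_bounded_closed)
qed

text \<open>
  The dual ball is norming: a point outside the ball of radius K is strictly separated from it,
  and the separating functional, rescaled, lies in the dual ball.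
\<close>

lemma norm_le_from_dual_ball:
  fixes N :: "'a::euclidean_space \<Rightarrow> real"
  assumes N: "is_norm N" and "K > 0" and le: "\<And>g. g \<in> dual_ball N \<Longrightarrow> g \<bullet> z \<le> K"
  shows "N z \<le> K"
proof (rule ccontr)
  assume "\<not> N z \<le> K"
  define z' where "z' = (1 / K) *\<^sub>R z"
  have "N z' > 1"
    using \<open>\<not> N z \<le> K\<close> \<open>K > 0\<close> by (simp add: z'_def is_norm_scaleR[OF N] field_simps)
  have "convex {x. N x \<le> 1}"
  proof (rule convexI)
    fix x y :: 'a and s t :: real
    assume *: "x \<in> {x. N x \<le> 1}" "y \<in> {x. N x \<le> 1}" "0 \<le> s" "0 \<le> t" "s + t = 1"
    have "N (s *\<^sub>R x + t *\<^sub>R y) \<le> s * N x + t * N y"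
      using is_norm_triangle[OF N, of "s *\<^sub>R x" "t *\<^sub>R y"] * by (simp add: is_norm_scaleR[OF N])
    also have "\<dots> \<le> s + t"
      using * by (intro add_mono mult_left_le) auto
    finally show "s *\<^sub>R x + t *\<^sub>R y \<in> {x. N x \<le> 1}" using * by simp
  qed
  then obtain a b where ab: "a \<bullet> z' < b" "\<forall>x\<in>{x. N x \<le> 1}. a \<bullet> x > b"
    using separating_hyperplane_closed_point[of "{x. N x \<le> 1}" z'] \<open>N z' > 1\<close>
      compact_imp_closed[OF compact_unit_ball[OF N]] by auto
  have "b < 0" using ab(2)[rule_format, of 0] is_norm_eq0[OF N, of 0] by simp
  define g where "g = (1 / b) *\<^sub>R a"
  have "g \<bullet> x \<le> N x" for x
  proof (cases "x = 0")
    case True then show ?thesis using is_norm_ge0[OF N] by simp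
  next
    case False
    then have "N x > 0" using is_norm_ge0[OF N, of x] is_norm_eq0[OF N, of x] by linarith
    then have "N ((1 / N x) *\<^sub>R x) \<le> 1" by (simp add: is_norm_scaleR[OF N])
    then have "a \<bullet> ((1 / N x) *\<^sub>R x) > b" using ab(2) by blast
    then show ?thesis using \<open>N x > 0\<close> \<open>b < 0\<close> by (simp add: g_def field_simps)
  qed
  then have "g \<bullet> z \<le> K" using le by (simp add: dual_ball_def)
  moreover have "g \<bullet> z' > 1" using ab(1) \<open>b < 0\<close> by (simp add: g_def field_simps)
  ultimately show False using \<open>K > 0\<close> by (simp add: z'_def field_simps)
qed

section \<open>Planes without good projections\<close>

text \<open>
  The only consequence of a relative projection constant 4/3 that limits the number of planes. It
  avoids the infimum and the supremum, and so passes easily to other coordinates.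
\<close>

definition no_good_projection :: "('a::real_vector \<Rightarrow> real) \<Rightarrow> 'a set \<Rightarrow> bool" where
  "no_good_projection N Y \<longleftrightarrow>
     (\<forall>P K. linear P \<longrightarrow> range P \<subseteq> Y \<longrightarrow> (\<forall>y\<in>Y. P y = y) \<longrightarrow> (\<forall>x. N (P x) \<le> K * N x) \<longrightarrow> 4 / 3 \<le> K)"

lemma bdd_above_onorm_wrt:
  assumes N: "is_norm N" and "bounded_linear_wrt N P"
  shows "bdd_above (range (\<lambda>x. N (P x) / N x))"
proof -
  obtain K where K: "\<And>x. N (P x) \<le> N x * K"
    using assms(2) unfolding bounded_linear_wrt_def by blast
  have "N (P x) / N x \<le> max K 0" for x
  proof (cases "N x = 0")
    case False
    then have "N x > 0" using is_norm_ge0[OF N, of x] by linarith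
    then have "N (P x) / N x \<le> K" using K[of x] by (simp add: field_simps)
    then show ?thesis by simp
  qed simp
  then show ?thesis by (auto intro!: bdd_aboveI)
qed

lemma onorm_wrt_ge:
  assumes "is_norm N" and "bounded_linear_wrt N P"
  shows "N (P x) / N x \<le> onorm_wrt N P"
  unfolding onorm_wrt_def using bdd_above_onorm_wrt[OF assms] by (rule cSUP_upper[rotated]) simp

lemma onorm_wrt_le:
  assumes N: "is_norm N" and "0 \<le> K" and K: "\<And>x. N (P x) \<le> K * N x"
  shows "onorm_wrt N P \<le> K"
  unfolding onorm_wrt_def
proof (rule cSUP_least)
  fix x
  show "N (P x) / N x \<le> K"
  proof (cases "N x = 0")
    case False
    then have "N x > 0" using is_norm_ge0[OF N, of x] by linarith
    then show ?thesis using K[of x] by (simp add: field_simps)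
  qed (use \<open>0 \<le> K\<close> in simp)
qed simp

lemma rel_proj_const_le:
  assumes N: "is_norm N" and P: "linear P" "range P \<subseteq> Y" "\<And>y. y \<in> Y \<Longrightarrow> P y = y"
    and K: "0 \<le> K" "\<And>x. N (P x) \<le> K * N x"
  shows "rel_proj_const N Y \<le> K"
proof -
  have *: "0 \<le> onorm_wrt N Q" if "projection_onto N Y Q" for Q
  proof -
    have b: "bounded_linear_wrt N Q" using that by (simp add: projection_onto_def)
    have "Q 0 = 0" using b linear_0 by (auto simp: bounded_linear_wrt_def)
    then show ?thesis using onorm_wrt_ge[OF N b, of 0] is_norm_eq0[OF N, of 0] by simp
  qed
  have "projection_onto N Y P"
    using P K unfolding projection_onto_def bounded_linear_wrt_def by (metis mult.commute)
  then have "rel_proj_const N Y \<le> onorm_wrt N P"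
    unfolding rel_proj_const_def using * by (intro cINF_lower bdd_belowI2[where m = 0]) auto
  also have "\<dots> \<le> K" by (rule onorm_wrt_le[OF N K])
  finally show ?thesis .
qed

lemma planes_43_no_good_projection:
  assumes N: "is_norm N" and Y: "Y \<in> planes_43 N"
  shows "no_good_projection N Y"
  unfolding no_good_projection_def
proof (intro allI impI)
  fix P K
  assume P: "linear P" "range P \<subseteq> Y" "\<forall>y\<in>Y. P y = y" "\<forall>x. N (P x) \<le> K * N x"
  have "dim Y = 2" using Y by (simp add: planes_43_def)
  then obtain B where B: "B \<subseteq> Y" "independent B" "card B = 2"
    using real_vector.basis_exists[of Y] by metis
  then obtain y where "y \<in> B" by fastforce
  then have y: "y \<in> Y" "y \<noteq> 0" using B real_vector.dependent_zero by auto
  then have "N y > 0" using is_norm_ge0[OF N, of y] is_norm_eq0[OF N, of y] by linarith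
  moreover have "N y \<le> K * N y" using P(3,4) y by metis
  ultimately have "0 \<le> K" by (simp add: zero_le_mult_iff)
  then have "rel_proj_const N Y \<le> K" using rel_proj_const_le[OF N] P by blast
  then show "4 / 3 \<le> K" using Y by (simp add: planes_43_def)
qed

section \<open>Caratheodory's theorem\<close>

text \<open>
  If the points of T have distinct first components, those are affinely dependent for dimension
  reasons; if two of them share the first component, their difference is such a dependency.
\<close>

lemma affine_dependency_fst:
  fixes T :: "('b::euclidean_space \<times> real) set"
  assumes "finite T" "card T \<ge> DIM('b) + 2"
  obtains d where "sum d T = 0" "(\<Sum>q\<in>T. d q *\<^sub>R fst q) = 0" "\<exists>q\<in>T. d q \<noteq> 0"
proof (cases "inj_on fst T")
  case True
  then have "affine_dependent (fst ` T)"
    using assms by (intro affine_dependent_biggerset) (auto simp: card_image)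
  then obtain U where U: "sum U (fst ` T) = 0" "\<exists>v\<in>fst ` T. U v \<noteq> 0"
      "(\<Sum>v\<in>fst ` T. U v *\<^sub>R v) = 0"
    using affine_dependent_explicit_finite[of "fst ` T"] assms(1) by auto
  show ?thesis
    by (rule that[of "U \<circ> fst"]) (use U in \<open>auto simp: sum.reindex[OF True] o_def\<close>)
next
  case False
  then obtain q r where qr: "q \<in> T" "r \<in> T" "q \<noteq> r" "fst q = fst r"
    by (auto simp: inj_on_def)
  define d where "d = (\<lambda>x. if x = q then 1 else if x = r then - 1 else 0 :: real)"
  have sum_T: "sum d T = sum d {q, r}"
    using qr assms(1) by (intro sum.mono_neutral_right) (auto simp: d_def)
  have sum_fst: "(\<Sum>x\<in>T. d x *\<^sub>R fst x) = (\<Sum>x\<in>{q, r}. d x *\<^sub>R fst x)"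
    using qr assms(1) by (intro sum.mono_neutral_right) (auto simp: d_def)
  show ?thesis
    by (rule that[of d], unfold sum_T sum_fst) (use qr in \<open>auto simp: d_def intro!: bexI[of _ q]\<close>)
qed

text \<open>
  A variant of Caratheodory's theorem that saves one point by tolerating an increase of the last
  coordinate. In a smallest set T whose hull contains a point on or above (p, r) over p, more than
  DIM('b) + 1 points would admit an affine dependency of the first components. Pushing the weights
  along it, in the direction that does not lower the last coordinate, eventually makes one weight
  vanish and so contradicts minimality.
\<close>

lemma caratheodory_upper:
  fixes S :: "('b::euclidean_space \<times> real) set"
  assumes "(p, r) \<in> convex hull S"
  obtains T r' where "T \<subseteq> S" "finite T" "card T \<le> DIM('b) + 1" "r \<le> r'"
    "(p, r') \<in> convex hull T"
proof -
  define Q where "Q T \<longleftrightarrow> T \<subseteq> S \<and> finite T \<and> (\<exists>r'\<ge>r. (p, r') \<in> convex hull T)" for T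
  obtain T0 where "Q T0"
    using assms unfolding caratheodory[of S] Q_def by blast
  then obtain T where T: "Q T" and least: "\<And>T'. Q T' \<Longrightarrow> card T \<le> card T'"
    using ex_has_least_nat[of Q T0 card] by blast
  obtain r' where r': "r \<le> r'" "(p, r') \<in> convex hull T" and fin: "finite T" "T \<subseteq> S"
    using T unfolding Q_def by blast
  have "card T \<le> DIM('b) + 1"
  proof (rule ccontr)
    assume "\<not> ?thesis"
    then have "card T \<ge> DIM('b) + 2" by simp
    then obtain e where e: "sum e T = 0" "(\<Sum>q\<in>T. e q *\<^sub>R fst q) = 0" "\<exists>q\<in>T. e q \<noteq> 0"
      using affine_dependency_fst[OF fin(1)] by blast
    \<comment> \<open>Orient the dependency so that moving along it does not lower the last coordinate.\<close>
    define d where "d = (if (\<Sum>q\<in>T. e q * snd q) \<ge> 0 then e else (\<lambda>q. - e q))"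
    have d: "sum d T = 0" "(\<Sum>q\<in>T. d q *\<^sub>R fst q) = 0" "\<exists>q\<in>T. d q \<noteq> 0"
        "(\<Sum>q\<in>T. d q * snd q) \<ge> 0"
      using e by (auto simp: d_def sum_negf)
    obtain u where u: "\<And>q. q \<in> T \<Longrightarrow> 0 \<le> u q" "sum u T = 1" "(\<Sum>q\<in>T. u q *\<^sub>R q) = (p, r')"
      using r'(2) unfolding convex_hull_finite[OF fin(1)] by blast
    have up: "(\<Sum>q\<in>T. u q *\<^sub>R fst q) = p" and ur: "(\<Sum>q\<in>T. u q * snd q) = r'"
      using arg_cong[OF u(3), of fst] arg_cong[OF u(3), of snd] by (simp_all add: fst_sum snd_sum)
    define D where "D = {q\<in>T. d q < 0}"
    have "D \<noteq> {}"
    proof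
      assume "D = {}"
      then have "\<forall>q\<in>T. 0 \<le> d q" by (auto simp: D_def not_less)
      then have "\<forall>q\<in>T. d q = 0" using d(1) fin(1) by (simp add: sum_nonneg_eq_0_iff)
      then show False using d(3) by blast
    qed
    moreover have "finite D" using fin(1) by (simp add: D_def)
    ultimately obtain q0 where q0: "q0 \<in> D" "\<forall>q\<in>D. u q0 / (- d q0) \<le> u q / (- d q)"
      using ex_min_if_finite[of "(\<lambda>q. u q / (- d q)) ` D"] 
      by (auto simp: not_less) 
    \<comment> \<open>The first time at which a weight reaches zero.\<close>
    define t where "t = u q0 / (- d q0)"
    have q0T: "q0 \<in> T" "d q0 < 0" using q0 by (auto simp: D_def)
    have "t \<ge> 0" using u(1)[OF q0T(1)] q0T(2) by (simp add: t_def divide_nonneg_neg)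
    define v where "v q = u q + t * d q" for q
    have v0: "v q0 = 0" using q0T(2) by (simp add: v_def t_def)
    have "v q \<ge> 0" if "q \<in> T" for q
    proof (cases "d q < 0")
      case True
      then have "t \<le> u q / (- d q)" using q0(2) that unfolding t_def D_def by blast
      then show ?thesis using True by (simp add: v_def field_simps)
    qed (use u(1)[OF that] \<open>t \<ge> 0\<close> in \<open>simp add: v_def\<close>)
    moreover have "sum v T = 1"
      using u(2) d(1) by (simp add: v_def sum.distrib flip: sum_distrib_left)
    moreover have "(\<Sum>q\<in>T. v q *\<^sub>R fst q) = p"
      using up d(2) by (simp add: v_def scaleR_add_left sum.distrib
          flip: scaleR_scaleR scaleR_sum_right)
    moreover have "(\<Sum>q\<in>T. v q * snd q) = r' + t * (\<Sum>q\<in>T. d q * snd q)"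
      using ur by (simp add: v_def distrib_right sum.distrib sum_distrib_left mult.assoc)
    ultimately have "(p, r' + t * (\<Sum>q\<in>T. d q * snd q)) \<in> convex hull (T - {q0})"
      unfolding convex_hull_finite[OF finite_Diff[OF fin(1)]]
      using v0 q0T(1) fin(1)
      by (auto intro!: exI[of _ v] simp: sum_diff1 fst_sum snd_sum prod_eq_iff)
    moreover have "r \<le> r' + t * (\<Sum>q\<in>T. d q * snd q)"
      using r'(1) \<open>t \<ge> 0\<close> d(4) by (simp add: add_increasing2)
    ultimately have "Q (T - {q0})" using fin unfolding Q_def by blast
    then have "card T \<le> card (T - {q0})" by (rule least)
    then show False using fin(1) q0T(1) by (metis card_Diff1_less linorder_not_less)
  qed
  then show ?thesis using that r' fin by blast
qed

section \<open>Duality\<close>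

lemma card_le_3_cases:
  assumes "finite T" "card T \<le> 3" "T \<noteq> {}"
  obtains a b c where "T = {a, b, c}"
proof -
  have "card T = 1 \<or> card T = 2 \<or> card T = 3"
    using assms card_gt_0_iff[of T] by linarith
  then show ?thesis
  proof (elim disjE)
    assume "card T = 1"
    then obtain a where "T = {a}" by (auto simp: card_1_singleton_iff)
    then show ?thesis using that[of a a a] by simp
  next
    assume "card T = 2"
    then obtain a b where "T = {a, b}" by (auto simp: card_2_iff)
    then show ?thesis using that[of a b b] by simp
  next
    assume "card T = 3"
    then obtain a b c where "T = {a, b, c}" by (auto simp: card_3_iff)
    then show ?thesis using that by blast
  qed
qed

text \<open>
  Convex duality. Projections onto the plane ker f have the form y - f(y) w with f(w) = 1, and the
  norm of such a projection is the supremum over x in the unit ball and g in the dual ball of the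
  functions g(x) - f(x) g(w), which are affine in w. If every such supremum is at least 4/3, then
  some convex combination of these affine functions is constant on the plane f(w) = 1 with value
  at least 4/3. As w varies in a plane, three of the functions suffice. Constancy says that the
  combination of the functionals f(x) g is a multiple of f.
\<close>

lemma norming_pairs_exist:
  fixes N :: "real^3 \<Rightarrow> real"
  assumes N: "is_norm N" and dimY: "dim Y = 2" and bad: "no_good_projection N Y"
    and f: "f \<noteq> 0" "Y = {y. f \<bullet> y = 0}"
  obtains x g :: "3 \<Rightarrow> real^3" and c :: "3 \<Rightarrow> real" and \<mu>
  where "\<And>i. N (x i) \<le> 1" "\<And>i. g i \<in> dual_ball N" "\<And>i. 0 \<le> c i" "(\<Sum>i\<in>UNIV. c i) = 1"
    "(\<Sum>i\<in>UNIV. (c i * (f \<bullet> x i)) *\<^sub>R g i) = \<mu> *\<^sub>R f"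
    "4 / 3 \<le> (\<Sum>i\<in>UNIV. c i * (g i \<bullet> x i)) - \<mu>"
proof -
  obtain B where B: "B \<subseteq> Y" "Y \<subseteq> span B" "card B = 2"
    using basis_exists[of Y] dimY by metis
  then obtain a b where ab: "B = {a, b}" by (auto simp: card_2_iff)
  have fab: "f \<bullet> a = 0" "f \<bullet> b = 0" using B ab f by auto
  define w0 where "w0 = (1 / (f \<bullet> f)) *\<^sub>R f"
  have fw0: "f \<bullet> w0 = 1" using f(1) by (simp add: w0_def)
  \<comment> \<open>F records the affine function of (x, g): its linear part in the basis a, b, and its value at w0.\<close>
  define F where "F = (\<lambda>(x, g). (((f \<bullet> x) * (g \<bullet> a), (f \<bullet> x) * (g \<bullet> b)), g \<bullet> x - (f \<bullet> x) * (g \<bullet> w0)))"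
  define S where "S = F ` ({x. N x \<le> 1} \<times> dual_ball N)"
  have "compact S"
    unfolding S_def
    by (intro compact_continuous_image compact_Times compact_unit_ball[OF N] compact_dual_ball[OF N])
      (auto simp: F_def case_prod_unfold intro!: continuous_intros)
  then have cpt: "compact (convex hull S)" by (rule compact_convex_hull)
  have "0 \<in> dual_ball N" using is_norm_ge0[OF N] by (simp add: dual_ball_def)
  then have "F (0, 0) \<in> S" using is_norm_eq0[OF N, of 0] by (auto simp: S_def)
  then have S0: "0 \<in> S" by (simp add: F_def zero_prod_def)
  \<comment> \<open>The constant affine functions with value at least 4/3.\<close>
  define D where "D = {(0::real, 0::real)} \<times> {4/3 :: real..}"
  have "convex hull S \<inter> D \<noteq> {}"
  proof
    assume "convex hull S \<inter> D = {}"
    moreover have "convex D" "closed D"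
      unfolding D_def by (intro convex_Times closed_Times; simp)+
    moreover have "convex hull S \<noteq> {}" using S0 by auto
    ultimately obtain n k where nk: "\<forall>q\<in>convex hull S. n \<bullet> q < k" "\<forall>q\<in>D. n \<bullet> q > k"
      using separating_hyperplane_compact_closed[OF convex_convex_hull cpt, of D] by blast
    obtain \<alpha> \<beta> t where n: "n = ((\<alpha>, \<beta>), t)" by (metis surj_pair)
    have "0 < k" using nk(1) S0 hull_subset[of S convex] by force
    have tk: "t * (4 / 3) > k" using nk(2)[rule_format, of "((0, 0), 4/3)"] by (simp add: D_def n inner_prod_def)
    then have "t > 0" using \<open>0 < k\<close> by simp
    \<comment> \<open>The separating functional, read as a point w, gives a projection with bound k / t < 4/3.\<close>
    define w where "w = w0 - (1 / t) *\<^sub>R (\<alpha> *\<^sub>R a + \<beta> *\<^sub>R b)"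
    have fw: "f \<bullet> w = 1" using fw0 fab by (simp add: w_def inner_diff_right inner_add_right)
    define P where "P y = y - (f \<bullet> y) *\<^sub>R w" for y
    have P1: "N (P x) \<le> k / t" if "N x \<le> 1" for x
    proof (rule norm_le_from_dual_ball[OF N])
      show "k / t > 0" using \<open>0 < k\<close> \<open>0 < t\<close> by simp
      fix g assume "g \<in> dual_ball N"
      then have "F (x, g) \<in> S" using that by (auto simp: S_def)
      then have "n \<bullet> F (x, g) < k" using nk(1) hull_subset[of S convex] by blast
      moreover have "n \<bullet> F (x, g) = t * (g \<bullet> P x)"
        using \<open>0 < t\<close>
        by (simp add: n F_def inner_prod_def P_def w_def inner_diff_right inner_add_right field_simps)
      ultimately show "g \<bullet> P x \<le> k / t" using \<open>0 < t\<close> by (simp add: field_simps)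
    qed
    have lin: "linear P"
      unfolding P_def by (intro linearI) (auto simp: inner_add_right algebra_simps)
    have "N (P x) \<le> k / t * N x" for x
    proof (cases "x = 0")
      case True
      then show ?thesis using is_norm_eq0[OF N, of 0] lin by (simp add: linear_0)
    next
      case False
      then have pos: "N x > 0" using is_norm_ge0[OF N, of x] is_norm_eq0[OF N, of x] by linarith
      then have "N ((1 / N x) *\<^sub>R x) \<le> 1" by (simp add: is_norm_scaleR[OF N])
      then have "N (P ((1 / N x) *\<^sub>R x)) \<le> k / t" by (rule P1)
      then show ?thesis
        using pos by (simp add: linear_scale[OF lin] is_norm_scaleR[OF N] field_simps)
    qed
    moreover have "range P \<subseteq> Y" "\<forall>y\<in>Y. P y = y"
      using fw by (auto simp: f(2) P_def inner_diff_right)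
    ultimately have "4 / 3 \<le> k / t"
      using bad lin unfolding no_good_projection_def by blast
    then show False using tk \<open>0 < t\<close> by (simp add: field_simps)
  qed
  then obtain r where r: "((0, 0), r) \<in> convex hull S" "4 / 3 \<le> r" by (auto simp: D_def)
  have dim_plane: "DIM(real \<times> real) + 1 = 3" by simp
  obtain T r' where T: "T \<subseteq> S" "finite T" "card T \<le> 3" "r \<le> r'" "((0, 0), r') \<in> convex hull T"
    using caratheodory_upper[OF r(1), unfolded dim_plane] by metis
  have "T \<noteq> {}" using T(5) by auto
  then obtain q1 q2 q3 where q: "T = {q1, q2, q3}" using card_le_3_cases T by metis
  obtain x1 x2 x3 g1 g2 g3 where
    xg: "q1 = F (x1, g1)" "q2 = F (x2, g2)" "q3 = F (x3, g3)"
    "N x1 \<le> 1" "N x2 \<le> 1" "N x3 \<le> 1"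
    "g1 \<in> dual_ball N" "g2 \<in> dual_ball N" "g3 \<in> dual_ball N"
    using T(1) unfolding q S_def by auto
  obtain c1 c2 c3 where c: "0 \<le> c1" "0 \<le> c2" "0 \<le> c3" "c1 + c2 + c3 = 1"
    "((0, 0), r') = c1 *\<^sub>R q1 + c2 *\<^sub>R q2 + c3 *\<^sub>R q3"
    using T(5) unfolding q convex_hull_3 by auto
  define x where "x i = (if i = (1::3) then x1 else if i = 2 then x2 else x3)" for i
  define g where "g i = (if i = (1::3) then g1 else if i = 2 then g2 else g3)" for i
  define cc where "cc i = (if i = (1::3) then c1 else if i = 2 then c2 else c3)" for i
  define v where "v = (\<Sum>i\<in>UNIV. (cc i * (f \<bullet> x i)) *\<^sub>R g i)"
  have v_eq: "v = (c1 * (f \<bullet> x1)) *\<^sub>R g1 + (c2 * (f \<bullet> x2)) *\<^sub>R g2 + (c3 * (f \<bullet> x3)) *\<^sub>R g3"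
    by (simp add: v_def sum_3 cc_def x_def g_def)
  have "v \<bullet> a = 0" "v \<bullet> b = 0" and
    r': "r' = c1 * (g1 \<bullet> x1) + c2 * (g2 \<bullet> x2) + c3 * (g3 \<bullet> x3) - v \<bullet> w0"
    using c(5) unfolding v_eq by (simp_all add: xg(1-3) F_def inner_add_left algebra_simps)
  \<comment> \<open>v annihilates the plane, so it is a multiple of f.\<close>
  have vY: "v \<bullet> y = 0" if "y \<in> Y" for y
  proof -
    have "y \<in> span B" using that B by blast
    then show ?thesis
    proof (induction rule: span_induct)
      case base
      then show ?case by (simp add: ab subspace_hyperplane)
    next
      case (step y)
      then show ?case using \<open>v \<bullet> a = 0\<close> \<open>v \<bullet> b = 0\<close> by (auto simp: ab)
    qed
  qed
  define \<mu> where "\<mu> = v \<bullet> w0"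
  define z where "z = v - \<mu> *\<^sub>R f"
  have "f \<bullet> z = 0"
    using f(1) by (simp add: z_def \<mu>_def w0_def inner_diff_right inner_commute)
  then have "v \<bullet> z = 0" using vY f(2) by blast
  then have "z \<bullet> z = 0"
    using \<open>f \<bullet> z = 0\<close> by (subst z_def) (simp add: inner_diff_left)
  then have v\<mu>: "v = \<mu> *\<^sub>R f" by (simp add: z_def)
  show ?thesis
  proof (rule that[of x g cc \<mu>])
    show "N (x i) \<le> 1" "g i \<in> dual_ball N" "0 \<le> cc i" for i
      using xg c by (auto simp: x_def g_def cc_def)
    show "(\<Sum>i\<in>UNIV. cc i) = 1" using c by (simp add: sum_3 cc_def)
    show "(\<Sum>i\<in>UNIV. (cc i * (f \<bullet> x i)) *\<^sub>R g i) = \<mu> *\<^sub>R f" using v\<mu> by (simp add: v_def)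
    show "4 / 3 \<le> (\<Sum>i\<in>UNIV. cc i * (g i \<bullet> x i)) - \<mu>"
      using r' r(2) T(4) by (simp add: sum_3 cc_def x_def g_def \<mu>_def)
  qed
qed

section \<open>The equality case of Bohnenblust's inequality\<close>

text \<open>
  The hypothesis bounds c * \<psi> by c / (1/3 + 2c), a concave function of c; the right-hand side is
  its tangent line at c = 1/3, which it touches only there.
\<close>

lemma bohnenblust_weight:
  fixes c \<psi> :: real
  assumes "0 \<le> c" "(1 / 3 + 2 * c) * \<psi> \<le> 1"
  shows "c * \<psi> \<le> (2 + 3 * c) / 9"
    and "c * \<psi> = (2 + 3 * c) / 9 \<Longrightarrow> c = 1 / 3"
proof -
  have "c * \<psi> \<le> c / (1 / 3 + 2 * c)"
    using assms by (metis add_pos_nonneg divide_pos_pos mult.commute mult_left_mono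
        mult_nonneg_nonneg pos_le_divide_eq times_divide_eq_right mult.right_neutral zero_le_numeral zero_less_numeral zero_less_one)
  moreover have eq: "(2 + 3 * c) / 9 - c / (1 / 3 + 2 * c) = 2 * (3 * c - 1)\<^sup>2 / (9 * (1 + 6 * c))"
    using assms(1) by (simp add: divide_simps power2_eq_square) (simp add: algebra_simps)
  moreover have "0 \<le> 2 * (3 * c - 1)\<^sup>2 / (9 * (1 + 6 * c))" using assms(1) by simp
  ultimately show "c * \<psi> \<le> (2 + 3 * c) / 9" by linarith
  assume "c * \<psi> = (2 + 3 * c) / 9"
  then have "2 * (3 * c - 1)\<^sup>2 / (9 * (1 + 6 * c)) \<le> 0"
    using \<open>c * \<psi> \<le> c / (1 / 3 + 2 * c)\<close> eq by linarith
  then show "c = 1 / 3" using assms(1)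
    by (simp add: divide_le_0_iff)
qed

text \<open>
  The inequality of Bohnenblust in dimension 3 with its equality case. Here c are the weights of
  three norming pairs, \<phi> i is f(x i) and e i j is g i (x j). Evaluating the eigenvector identity at
  x j, where all e i j are at least -1, bounds \<phi> j by A / (1/3 + 2 c j), with A the weighted mean
  of \<phi>. Averaging again gives 1 \<le> \<Sum> c j / (1/3 + 2 c j), while concavity gives the reverse, so
  that every inequality on the way is an equality.
\<close>

lemma bohnenblust_equality:
  fixes c \<phi> :: "3 \<Rightarrow> real" and e :: "3 \<Rightarrow> 3 \<Rightarrow> real"
  assumes c: "\<And>i. 0 \<le> c i" "(\<Sum>i\<in>UNIV. c i) = 1" and \<phi>: "\<And>i. 0 \<le> \<phi> i"
    and e: "\<And>i j. \<bar>e i j\<bar> \<le> 1"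
    and eig: "\<And>j. (\<Sum>i\<in>UNIV. c i * \<phi> i * e i j) = \<mu> * \<phi> j"
    and A: "(\<Sum>i\<in>UNIV. c i * \<phi> i) \<noteq> 0"
    and large: "4 / 3 \<le> (\<Sum>i\<in>UNIV. c i * e i i) - \<mu>"
  shows "c i = 1 / 3" "\<phi> i = \<phi> 1" "0 < \<phi> 1" "\<mu> = - 1 / 3" "e i j = (if i = j then 1 else - 1)"
proof -
  define A where "A = (\<Sum>i\<in>UNIV. c i * \<phi> i)"
  have Apos: "A > 0"
    using A sum_nonneg[of UNIV "\<lambda>i. c i * \<phi> i"] c \<phi> unfolding A_def by (simp add: less_le)
  have \<mu>le: "- \<mu> * \<phi> j \<le> A - c j * \<phi> j * (1 + e j j)" for j
  proof -
    have nonneg: "0 \<le> 1 + e i j" for i using e[of i j] by linarith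
    have "(\<Sum>i\<in>UNIV. c i * \<phi> i * (1 + e i j)) \<ge> c j * \<phi> j * (1 + e j j)"
      using c \<phi> nonneg by (intro member_le_sum) auto
    moreover have "(\<Sum>i\<in>UNIV. c i * \<phi> i * (1 + e i j)) = A + \<mu> * \<phi> j"
      by (simp add: distrib_left sum.distrib A_def eig)
    ultimately show ?thesis by simp
  qed
  have key: "(1 / 3 + 2 * c j) * \<phi> j \<le> A" for j
  proof -
    have "(\<Sum>i\<in>UNIV. c i * (1 - e i i)) \<ge> c j * (1 - e j j)"
      using c e by (intro member_le_sum) (auto simp: abs_le_iff)
    then have "1 / 3 + 2 * c j \<le> - \<mu> + c j * (1 + e j j)"
      using large c(2) by (simp add: right_diff_distrib sum_subtractf distrib_left)
    then have "(1 / 3 + 2 * c j) * \<phi> j \<le> (- \<mu> + c j * (1 + e j j)) * \<phi> j"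
      using \<phi> by (rule mult_right_mono)
    also have "\<dots> \<le> A" using \<mu>le[of j] by (simp add: algebra_simps)
    finally show ?thesis .
  qed
  define \<psi> where "\<psi> i = \<phi> i / A" for i
  have key': "(1 / 3 + 2 * c j) * \<psi> j \<le> 1" for j
    using key[of j] Apos by (simp add: \<psi>_def field_simps)
  have sum\<psi>: "(\<Sum>i\<in>UNIV. c i * \<psi> i) = 1"
    using Apos by (simp add: \<psi>_def A_def flip: sum_divide_distrib)
  \<comment> \<open>The tangent line bounds already add up to 1, so none of them is strict.\<close>
  have "(\<Sum>i\<in>UNIV. (2 + 3 * c i) / 9 - c i * \<psi> i) = 0"
    using sum\<psi> c(2) by (simp add: sum_3 field_simps)
  then have "\<forall>i. (2 + 3 * c i) / 9 - c i * \<psi> i = 0"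
    using bohnenblust_weight(1)[OF c(1) key'] by (subst (asm) sum_nonneg_eq_0_iff) auto
  then have weight_eq: "c i * \<psi> i = (2 + 3 * c i) / 9" for i by simp
  then have c3: "c i = 1 / 3" for i
    using bohnenblust_weight(2)[OF c(1) key'] by blast
  have "\<psi> i = 1" for i using weight_eq[of i] by (simp add: c3)
  then have \<phi>A: "\<phi> i = A" for i using Apos by (simp add: \<psi>_def field_simps)
  show "c i = 1 / 3" by (rule c3)
  show "\<phi> i = \<phi> 1" "0 < \<phi> 1" using \<phi>A Apos by simp_all
  have \<mu>1: "- \<mu> \<le> 1 - (1 + e j j) / 3" for j
  proof -
    have "- \<mu> * A \<le> (1 - (1 + e j j) / 3) * A" using \<mu>le[of j] by (simp add: c3 \<phi>A field_simps)
    then show ?thesis using Apos by (rule mult_right_le_imp_le)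
  qed
  have large': "4 / 3 \<le> (e 1 1 + e 2 2 + e 3 3) / 3 - \<mu>"
    using large by (simp add: sum_3 c3 add_divide_distrib)
  have "e 1 1 \<le> 1" "e 2 2 \<le> 1" "e 3 3 \<le> 1"
    using e[of 1 1] e[of 2 2] e[of 3 3] by (simp_all add: abs_le_iff)
  note bounds = this large' \<mu>1[of 1] \<mu>1[of 2] \<mu>1[of 3]
  have ed: "e 1 1 = 1" "e 2 2 = 1" "e 3 3 = 1"
    subgoal using bounds by argo
    subgoal using bounds by argo
    subgoal using bounds by argo
    done
  then show \<mu>: "\<mu> = - 1 / 3" using large' \<mu>1[of 1] by simp
  have "(e 1 j + e 2 j + e 3 j) * A = - A" for j using eig[of j] by (simp add: c3 \<phi>A sum_3 \<mu> field_simps)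
  then have "e 1 j + e 2 j + e 3 j = - 1" for j using Apos 
    by (metis mult_cancel_right mult_minus1 less_irrefl)
  from this[of 1] this[of 2] this[of 3]
  show "e i j = (if i = j then 1 else - 1)"
    using ed e[of 1 2] e[of 1 3] e[of 2 1] e[of 2 3] e[of 3 1] e[of 3 2] exhaust_3[of i] exhaust_3[of j]
    by (auto simp: abs_le_iff)
qed

text \<open>
  The rigid configuration forced by a plane with constant 4/3. It squeezes the unit ball between
  the octahedron with vertices \<plusminus>x i and the parallelepiped on which all g i are bounded by 1 in
  absolute value. The vertices of the parallelepiped are \<plusminus>x i and \<plusminus>(x 1 + x 2 + x 3), so that six
  faces of the octahedron lie in the boundary of the ball, and the ball can exceed the octahedron
  only beyond the two remaining opposite faces.
\<close>

locale extremal_system =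
  fixes N :: "real^3 \<Rightarrow> real" and x g :: "3 \<Rightarrow> real^3"
  assumes norm: "is_norm N"
    and ball: "N (x i) \<le> 1"
    and dual: "g i \<in> dual_ball N"
    and pairing: "g i \<bullet> x j = (if i = j then 1 else - 1)"

lemma dual_ball_abs:
  assumes N: "is_norm N" and g: "g \<in> dual_ball N"
  shows "\<bar>g \<bullet> y\<bar> \<le> N y"
proof -
  have "g \<bullet> y \<le> N y" "g \<bullet> (- y) \<le> N (- y)" using g unfolding dual_ball_def by blast+
  then show ?thesis by (simp add: is_norm_minus[OF N] abs_le_iff)
qed

text \<open>
  Replacing both members of a norming pair by their negatives changes none of the identities, so
  f can be taken nonnegative on the points; the equality case then applies. All f(x i) and all
  weights being equal, f is proportional to the sum of the g i.
\<close>

lemma extremal_system_exists: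
  fixes N :: "real^3 \<Rightarrow> real"
  assumes N: "is_norm N" and dimY: "subspace Y" "dim Y = 2" and bad: "no_good_projection N Y"
  obtains x g where "extremal_system N x g" "Y = {y. (\<Sum>i\<in>UNIV. g i) \<bullet> y = 0}"
proof -
  have "span Y = Y" using dimY by (simp add: span_eq_iff)
  moreover have "\<exists>f. f \<noteq> 0 \<and> span Y = {y. f \<bullet> y = 0}"
    using dim_eq_hyperplane[of Y] dimY(2) by simp
  ultimately obtain f where f: "f \<noteq> 0" "Y = {y. f \<bullet> y = 0}" by metis
  obtain x g :: "3 \<Rightarrow> real^3" and c :: "3 \<Rightarrow> real" and \<mu>
    where xg: "\<And>i. N (x i) \<le> 1" "\<And>i. g i \<in> dual_ball N"
      and c: "\<And>i. 0 \<le> c i" "(\<Sum>i\<in>UNIV. c i) = 1"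
      and eig: "(\<Sum>i\<in>UNIV. (c i * (f \<bullet> x i)) *\<^sub>R g i) = \<mu> *\<^sub>R f"
      and large: "4 / 3 \<le> (\<Sum>i\<in>UNIV. c i * (g i \<bullet> x i)) - \<mu>"
    by (rule norming_pairs_exist[OF N dimY(2) bad f], rule that)
  define s :: "3 \<Rightarrow> real" where "s i = (if f \<bullet> x i \<ge> 0 then 1 else - 1)" for i
  have ss: "s i * s i = 1" and abss: "\<bar>s i\<bar> = 1" for i by (simp_all add: s_def)
  define x' where "x' i = s i *\<^sub>R x i" for i
  define g' where "g' i = s i *\<^sub>R g i" for i
  have x': "N (x' i) \<le> 1" for i using xg by (simp add: x'_def is_norm_scaleR[OF N] abss)
  have g': "g' i \<in> dual_ball N" for i
    unfolding dual_ball_def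
  proof safe
    fix y
    show "g' i \<bullet> y \<le> N y"
      using dual_ball_abs[OF N xg(2), of i y] by (auto simp: g'_def s_def abs_le_iff)
  qed
  have eig': "(\<Sum>i\<in>UNIV. (c i * (f \<bullet> x' i)) *\<^sub>R g' i) = \<mu> *\<^sub>R f"
    unfolding eig[symmetric] by (rule sum.cong) (use ss in \<open>auto simp: x'_def g'_def s_def\<close>)
  have inner': "g' i \<bullet> x' i = g i \<bullet> x i" for i by (simp add: x'_def g'_def s_def)
  have "N (x' j) \<le> 1 \<Longrightarrow> \<bar>g' i \<bullet> x' j\<bar> \<le> 1" for i j
    using dual_ball_abs[OF N g', of i "x' j"] by linarith
  then have abs': "\<bar>g' i \<bullet> x' j\<bar> \<le> 1" for i j using x' by blast
  have nz: "(\<Sum>i\<in>UNIV. c i * (f \<bullet> x' i)) \<noteq> 0"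
  proof
    assume "(\<Sum>i\<in>UNIV. c i * (f \<bullet> x' i)) = 0"
    then have "\<forall>i. c i * (f \<bullet> x' i) = 0"
      using c by (subst (asm) sum_nonneg_eq_0_iff) (auto simp: x'_def s_def)
    then have "\<mu> *\<^sub>R f = 0" unfolding eig'[symmetric] by (intro sum.neutral) auto
    then have "\<mu> = 0" using f by simp
    moreover have "(\<Sum>i\<in>UNIV. c i * (g' i \<bullet> x' i)) \<le> (\<Sum>i\<in>UNIV. c i)"
      using c abs' by (intro sum_mono mult_left_le) (auto simp: abs_le_iff)
    ultimately show False using large c by (simp add: inner')
  qed
  have eq: "(\<Sum>i\<in>UNIV. c i * (f \<bullet> x' i) * (g' i \<bullet> x' j)) = \<mu> * (f \<bullet> x' j)" for j
    using arg_cong[OF eig', of "\<lambda>v. v \<bullet> x' j"] by (simp add: inner_sum_left)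
  have large': "4 / 3 \<le> (\<Sum>i\<in>UNIV. c i * (g' i \<bullet> x' i)) - \<mu>"
    using large by (simp only: inner')
  have fx': "0 \<le> f \<bullet> x' i" for i by (simp add: x'_def s_def)
  note eqs = bohnenblust_equality[of c "\<lambda>i. f \<bullet> x' i" "\<lambda>i j. g' i \<bullet> x' j" \<mu>,
      OF c fx' abs' eq nz large']
  have "(c i * (f \<bullet> x' i)) *\<^sub>R g' i = (1 / 3 * (f \<bullet> x' 1)) *\<^sub>R g' i" for i
    using eqs(1)[of i] eqs(2)[of i] by presburger
  then have "(\<Sum>i\<in>UNIV. (1 / 3 * (f \<bullet> x' 1)) *\<^sub>R g' i) = (- 1 / 3) *\<^sub>R f"
    using eig' eqs(4) by presburger
  then have "(1 / 3 * (f \<bullet> x' 1)) *\<^sub>R (\<Sum>i\<in>UNIV. g' i) = (- 1 / 3) *\<^sub>R f"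
    by (simp only: scaleR_sum_right)
  then have "1 / 3 * (f \<bullet> x' 1) * ((\<Sum>i\<in>UNIV. g' i) \<bullet> y) = - 1 / 3 * (f \<bullet> y)" for y
    by (metis inner_scaleR_left)
  then have "(\<Sum>i\<in>UNIV. g' i) \<bullet> y = 0 \<longleftrightarrow> f \<bullet> y = 0" for y
    using eqs(3) by (smt (verit) mult_eq_0_iff divide_eq_0_iff)
  then have "Y = {y. (\<Sum>i\<in>UNIV. g' i) \<bullet> y = 0}" using f by simp
  moreover have "extremal_system N x' g'"
    using N x' g' eqs(5) by unfold_locales auto
  ultimately show ?thesis using that by blast
qed

section \<open>Comparing two extremal systems\<close>

lemma sum_over_3:
  fixes i j k :: 3
  assumes "i \<noteq> j" "i \<noteq> k" "j \<noteq> k"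
  shows "(\<Sum>l\<in>UNIV. f l) = f i + f j + (f k :: 'b::ab_group_add)"
  using assms exhaust_3[of i] exhaust_3[of j] exhaust_3[of k] by (auto simp: sum_3)

lemma UNIV_3_eq:
  fixes i j k l :: 3
  assumes "i \<noteq> j" "i \<noteq> k" "j \<noteq> k"
  shows "l = i \<or> l = j \<or> l = k"
  using assms exhaust_3[of i] exhaust_3[of j] exhaust_3[of k] exhaust_3[of l] by auto

lemma third_index:
  fixes i j :: 3
  assumes "i \<noteq> j"
  obtains k where "i \<noteq> k" "j \<noteq> k"
proof -
  have "\<exists>k. i \<noteq> k \<and> j \<noteq> k"
    using exhaust_3[of i] exhaust_3[of j] by (auto intro: exI[of _ 1] exI[of _ 2] exI[of _ 3])
  then show ?thesis using that by blast
qed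

context extremal_system
begin

text \<open>
  The coordinate functionals of the basis x: the sum of all g l is the negative of the sum of the
  coordinates, and g i is twice the i-th coordinate minus that sum.
\<close>

definition coord :: "3 \<Rightarrow> real^3" where
  "coord i = (1 / 2) *\<^sub>R (g i - (\<Sum>l\<in>UNIV. g l))"

lemma coord_x: "coord i \<bullet> x j = (if i = j then 1 else 0)"
proof -
  have "(\<Sum>l\<in>UNIV. g l \<bullet> x j) = - 1"
    using exhaust_3[of j] by (auto simp: sum_3 pairing)
  then show ?thesis by (simp add: coord_def inner_diff_left inner_sum_left pairing)
qed

lemma expand: "y = (\<Sum>i\<in>UNIV. (coord i \<bullet> y) *\<^sub>R x i)"
proof -
  define L where "L a = (\<Sum>i\<in>UNIV. (a $ i) *\<^sub>R x i)" for a :: "real^3"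
  have lin: "linear L"
    unfolding L_def by (intro linearI) (auto simp: scaleR_add_left sum.distrib scaleR_sum_right)
  have coord_L: "coord j \<bullet> L a = a $ j" for j a
    by (simp add: L_def inner_sum_right coord_x if_distrib cong: if_cong)
  have "inj L"
    by (rule injI) (metis coord_L vec_eq_iff)
  then have "surj L" using linear_injective_imp_surjective[OF lin] by simp
  then obtain a where "y = L a" by (metis surjD)
  then show ?thesis using coord_L unfolding L_def by simp
qed

lemma inner_expand: "h \<bullet> y = (\<Sum>i\<in>UNIV. (h \<bullet> x i) * (coord i \<bullet> y))"
  by (subst expand[of y]) (simp add: inner_sum_right mult.commute)

lemma functional_eqI: "(\<And>i. h \<bullet> x i = h' \<bullet> x i) \<Longrightarrow> h = h'"
  using inner_expand[of h] inner_expand[of h'] by (metis (no_types, lifting) inner_left_distrib sum.cong vector_eq_rdot)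

lemma vector_eqI: "(\<And>i. coord i \<bullet> y = coord i \<bullet> z) \<Longrightarrow> y = z"
  by (metis (no_types, lifting) expand sum.cong)

lemma g_coord:
  assumes "i \<noteq> j" "i \<noteq> k" "j \<noteq> k"
  shows "g i \<bullet> y = coord i \<bullet> y - coord j \<bullet> y - coord k \<bullet> y"
  using assms by (subst inner_expand) (simp add: sum_over_3[OF assms] pairing)

lemma abs_g_le: "N y \<le> 1 \<Longrightarrow> \<bar>g i \<bullet> y\<bar> \<le> 1"
  using dual_ball_abs[OF norm dual, of i y] by linarith

lemma abs_dual_x: "h \<in> dual_ball N \<Longrightarrow> \<bar>h \<bullet> x i\<bar> \<le> 1"
  using dual_ball_abs[OF norm, of h "x i"] ball[of i] by linarith

lemma abs_coord_le:
  assumes "N y \<le> 1"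
  shows "\<bar>coord i \<bullet> y\<bar> \<le> 1"
proof -
  obtain j where ij: "i \<noteq> j" by (metis zero_neq_one)
  then obtain k where k: "i \<noteq> k" "j \<noteq> k" by (rule third_index)
  show ?thesis
    using g_coord[of j i k y] g_coord[of k i j y] ij k abs_g_le[OF assms, of j] abs_g_le[OF assms, of k]
    by auto
qed

text \<open>
  In an octant where the coordinates have mixed signs the ball coincides with the octahedron: one
  of the \<plusminus>g l computes the l1 norm of y there. A functional of norm 1 that attains its norm at y
  must therefore take the extreme value at each x l with a nonzero coordinate.
\<close>

lemma mixed_signs:
  assumes h: "h \<in> dual_ball N" and y: "N y \<le> 1" "h \<bullet> y = 1"
    and pos: "coord i \<bullet> y > 0" and neg: "coord j \<bullet> y < 0"
  shows "(h \<bullet> x l) * (coord l \<bullet> y) = \<bar>coord l \<bullet> y\<bar>"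
proof -
  have ij: "i \<noteq> j" using pos neg by auto
  then obtain k where k: "i \<noteq> k" "j \<noteq> k" by (rule third_index)
  have le: "(h \<bullet> x l) * (coord l \<bullet> y) \<le> \<bar>coord l \<bullet> y\<bar>" for l
  proof -
    have "\<bar>(h \<bullet> x l) * (coord l \<bullet> y)\<bar> \<le> \<bar>coord l \<bullet> y\<bar>"
      using abs_dual_x[OF h, of l] by (simp add: abs_mult mult_left_le_one_le)
    then show ?thesis by linarith
  qed
  have "\<bar>coord i \<bullet> y\<bar> + \<bar>coord j \<bullet> y\<bar> + \<bar>coord k \<bullet> y\<bar> \<le> 1"
    using g_coord[of i j k y] g_coord[of j i k y] ij k abs_g_le[OF y(1), of i] abs_g_le[OF y(1), of j] pos neg
    by auto
  moreover have "(h \<bullet> x i) * (coord i \<bullet> y) + (h \<bullet> x j) * (coord j \<bullet> y) + (h \<bullet> x k) * (coord k \<bullet> y) = 1"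
    using y(2) inner_expand[of h y] sum_over_3[OF ij k] by metis
  ultimately show ?thesis
    using le[of i] le[of j] le[of k] UNIV_3_eq[OF ij k, of l] by auto
qed

text \<open>
  The face along which h supports the ball is assumed to lie in no coordinate plane. If it meets
  an open octant of mixed signs, then h is determined there and is some \<plusminus>g k. If it meets mixed
  signs only within a coordinate plane and h is no \<plusminus>g k, then the remaining value of h is not
  extreme, and this confines the whole face to that plane. Otherwise each contact point is of one
  sign, and by convexity the sign is the same for all of them, since a switch would pass through 0.
\<close>

lemma contact_trichotomy:
  assumes h: "h \<in> dual_ball N"
    and nondegenerate: "\<And>k. \<exists>y. N y \<le> 1 \<and> h \<bullet> y = 1 \<and> coord k \<bullet> y \<noteq> 0"
  shows "(\<exists>k s. \<bar>s\<bar> = 1 \<and> h = s *\<^sub>R g k) \<or>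
    (\<exists>s. \<bar>s\<bar> = 1 \<and> (\<forall>y. N y \<le> 1 \<and> h \<bullet> y = 1 \<longrightarrow> (\<forall>k. 0 \<le> s * (coord k \<bullet> y))))"
proof (cases "\<exists>k s. \<bar>s\<bar> = 1 \<and> h = s *\<^sub>R g k")
  case False
  have not_g: "h \<noteq> g k" "h \<noteq> - g k" for k
  proof -
    show "h \<noteq> g k" using False by (metis abs_one scaleR_one)
    show "h \<noteq> - g k" using False by (metis abs_minus abs_one scaleR_minus1_left)
  qed
  have no_mixed: "\<not> (coord i \<bullet> y > 0 \<and> coord j \<bullet> y < 0)" if y: "N y \<le> 1" "h \<bullet> y = 1" for i j y
  proof
    assume *: "coord i \<bullet> y > 0 \<and> coord j \<bullet> y < 0"
    then have ij: "i \<noteq> j" by auto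
    then obtain k where k: "i \<noteq> k" "j \<noteq> k" by (rule third_index)
    have hi: "h \<bullet> x i = 1" using mixed_signs[OF h y, of i j i] * by auto
    have hj: "h \<bullet> x j = - 1"
    proof -
      have "(h \<bullet> x j + 1) * (coord j \<bullet> y) = 0"
        using mixed_signs[OF h y, of i j j] * by (simp add: distrib_right abs_if)
      then show ?thesis using * by simp
    qed
    have hk: "\<bar>h \<bullet> x k\<bar> \<noteq> 1"
    proof
      assume "\<bar>h \<bullet> x k\<bar> = 1"
      then consider "h \<bullet> x k = 1" | "h \<bullet> x k = - 1" by linarith
      then show False
      proof cases
        case 1
        have "h = - g j"
        proof (rule functional_eqI)
          fix l show "h \<bullet> x l = (- g j) \<bullet> x l"
            using UNIV_3_eq[OF ij k, of l] 1 hi hj ij k by (auto simp: pairing)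
        qed
        then show False using not_g by blast
      next
        case 2
        have "h = g i"
        proof (rule functional_eqI)
          fix l show "h \<bullet> x l = g i \<bullet> x l"
            using UNIV_3_eq[OF ij k, of l] 2 hi hj ij k by (auto simp: pairing)
        qed
        then show False using not_g by blast
      qed
    qed
    obtain z where z: "N z \<le> 1" "h \<bullet> z = 1" "coord k \<bullet> z \<noteq> 0" using nondegenerate by blast
    \<comment> \<open>A small step from the middle of the edge between x i and - x j towards z keeps the mixed
      signs and makes the k-th coordinate nonzero.\<close>
    define w where "w = (3 / 8) *\<^sub>R x i + ((3 / 8) *\<^sub>R (- x j) + (1 / 4) *\<^sub>R z)"
    have "N w \<le> 3 / 8 * N (x i) + (3 / 8 * N (- x j) + 1 / 4 * N z)"
      unfolding w_def
      using is_norm_triangle[OF norm, of "(3 / 8) *\<^sub>R x i" "(3 / 8) *\<^sub>R (- x j) + (1 / 4) *\<^sub>R z"]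
        is_norm_triangle[OF norm, of "(3 / 8) *\<^sub>R (- x j)" "(1 / 4) *\<^sub>R z"]
        is_norm_scaleR[OF norm, of "3 / 8" "x i"] is_norm_scaleR[OF norm, of "3 / 8" "- x j"]
        is_norm_scaleR[OF norm, of "1 / 4" z] by linarith
    then have Nw: "N w \<le> 1" using ball[of i] ball[of j] z(1) by (simp add: is_norm_minus[OF norm])
    have hw: "h \<bullet> w = 1" by (simp add: w_def inner_add_right inner_diff_right hi hj z)
    have cw: "coord i \<bullet> w > 0" "coord j \<bullet> w < 0" "coord k \<bullet> w = coord k \<bullet> z / 4"
      using abs_coord_le[OF z(1), of i] abs_coord_le[OF z(1), of j] ij k
      by (auto simp: w_def inner_add_right inner_diff_right coord_x)
    have "(h \<bullet> x k) * (coord k \<bullet> w) = \<bar>coord k \<bullet> w\<bar>"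
      using mixed_signs[OF h Nw hw cw(1,2)] .
    then have "\<bar>h \<bullet> x k\<bar> * \<bar>coord k \<bullet> w\<bar> = 1 * \<bar>coord k \<bullet> w\<bar>"
      by (metis abs_abs abs_mult mult_1)
    then have "\<bar>h \<bullet> x k\<bar> = 1" using cw(3) z(3) by simp
    then show False using hk by blast
  qed
  \<comment> \<open>The sign of the coordinate sum tells the two octants apart and vanishes at no contact point.\<close>
  define \<sigma> where "\<sigma> y = coord 1 \<bullet> y + coord 2 \<bullet> y + coord 3 \<bullet> y" for y
  have sign: "(\<forall>k. 0 \<le> coord k \<bullet> y) \<or> (\<forall>k. coord k \<bullet> y \<le> 0)" if "N y \<le> 1" "h \<bullet> y = 1" for y
  proof (rule ccontr)
    assume "\<not> ?thesis"
    then obtain i j where "coord i \<bullet> y > 0" "coord j \<bullet> y < 0" by (auto simp: not_le)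
    then show False using no_mixed[OF that] by blast
  qed
  have zero: "\<sigma> y \<noteq> 0" if y: "N y \<le> 1" "h \<bullet> y = 1" for y
  proof
    assume 0: "\<sigma> y = 0"
    have "coord k \<bullet> y = 0" for k
      using sign[OF y]
    proof
      assume "\<forall>k. 0 \<le> coord k \<bullet> y"
      then have "0 \<le> coord 1 \<bullet> y" "0 \<le> coord 2 \<bullet> y" "0 \<le> coord 3 \<bullet> y" by blast+
      then show ?thesis using 0 exhaust_3[of k] by (auto simp: \<sigma>_def)
    next
      assume "\<forall>k. coord k \<bullet> y \<le> 0"
      then have "coord 1 \<bullet> y \<le> 0" "coord 2 \<bullet> y \<le> 0" "coord 3 \<bullet> y \<le> 0" by blast+
      then show ?thesis using 0 exhaust_3[of k] by (auto simp: \<sigma>_def)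
    qed
    then have "y = 0" by (intro vector_eqI) simp
    then show False using y by simp
  qed
  have pos: "\<forall>k. 0 \<le> coord k \<bullet> y" if "N y \<le> 1" "h \<bullet> y = 1" "\<sigma> y > 0" for y
  proof (rule ccontr)
    assume "\<not> ?thesis"
    then have "\<forall>k. coord k \<bullet> y \<le> 0" using sign that by blast
    then have "coord 1 \<bullet> y \<le> 0" "coord 2 \<bullet> y \<le> 0" "coord 3 \<bullet> y \<le> 0" by blast+
    then show False using that(3) by (simp add: \<sigma>_def)
  qed
  have neg: "\<forall>k. coord k \<bullet> y \<le> 0" if "N y \<le> 1" "h \<bullet> y = 1" "\<sigma> y < 0" for y
  proof (rule ccontr)
    assume "\<not> ?thesis"
    then have "\<forall>k. 0 \<le> coord k \<bullet> y" using sign that by blast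
    then have "0 \<le> coord 1 \<bullet> y" "0 \<le> coord 2 \<bullet> y" "0 \<le> coord 3 \<bullet> y" by blast+
    then show False using that(3) by (simp add: \<sigma>_def)
  qed
  have "\<not> (\<sigma> y > 0 \<and> \<sigma> z < 0)" if y: "N y \<le> 1" "h \<bullet> y = 1" and z: "N z \<le> 1" "h \<bullet> z = 1" for y z
  proof
    assume *: "\<sigma> y > 0 \<and> \<sigma> z < 0"
    define d where "d = \<sigma> y - \<sigma> z"
    \<comment> \<open>The point of the segment from y to z whose coordinate sum is 0.\<close>
    define u v where "u = - \<sigma> z / d" and "v = \<sigma> y / d"
    have "d > 0" using * by (simp add: d_def)
    have "u + v = (- \<sigma> z + \<sigma> y) / d" by (simp only: u_def v_def add_divide_distrib)
    also have "- \<sigma> z + \<sigma> y = d" by (simp add: d_def)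
    finally have "u + v = d / d" .
    moreover have "0 \<le> u" "0 \<le> v"
      using * \<open>d > 0\<close> unfolding u_def v_def by (intro divide_nonneg_pos; simp)+
    ultimately have uv: "0 \<le> u" "0 \<le> v" "u + v = 1" using \<open>d > 0\<close> by simp_all
    define w where "w = u *\<^sub>R y + v *\<^sub>R z"
    have "N w \<le> u * N y + v * N z"
      using is_norm_triangle[OF norm, of "u *\<^sub>R y" "v *\<^sub>R z"] uv by (simp add: w_def is_norm_scaleR[OF norm])
    also have "\<dots> \<le> u + v" using uv y z by (intro add_mono mult_left_le) auto
    finally have "N w \<le> 1" using uv by simp
    moreover have "h \<bullet> w = 1" using uv y z by (simp add: w_def inner_add_right)
    moreover have "\<sigma> w = u * \<sigma> y + v * \<sigma> z" by (simp add: w_def \<sigma>_def inner_add_right algebra_simps)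
    then have "\<sigma> w = 0" by (simp add: u_def v_def)
    ultimately show False using zero by blast
  qed
  then have "(\<forall>y. N y \<le> 1 \<and> h \<bullet> y = 1 \<longrightarrow> \<sigma> y > 0) \<or> (\<forall>y. N y \<le> 1 \<and> h \<bullet> y = 1 \<longrightarrow> \<sigma> y < 0)"
    using zero by (metis linorder_neqE_linordered_idom)
  then have "\<exists>s. \<bar>s\<bar> = 1 \<and> (\<forall>y. N y \<le> 1 \<and> h \<bullet> y = 1 \<longrightarrow> (\<forall>k. 0 \<le> s * (coord k \<bullet> y)))"
  proof
    assume "\<forall>y. N y \<le> 1 \<and> h \<bullet> y = 1 \<longrightarrow> \<sigma> y > 0"
    then show ?thesis using pos by (intro exI[of _ 1]) simp
  next
    assume "\<forall>y. N y \<le> 1 \<and> h \<bullet> y = 1 \<longrightarrow> \<sigma> y < 0"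
    then show ?thesis using neg by (intro exI[of _ "- 1"]) simp
  qed
  then show ?thesis by blast
qed blast

text \<open>
  How far the ball reaches along the ray from x k in direction x i + x j; the value lies between 0
  (octahedron) and 1 (parallelepiped).
\<close>

definition apex :: "3 \<Rightarrow> real" where
  "apex k = Sup {t. N (x k + t *\<^sub>R ((\<Sum>l\<in>UNIV. x l) - x k)) \<le> 1}"

text \<open>
  The kernel of g i + g j + h, where h takes the value 1 at x i, at x j and at the point of the
  ball furthest along the ray that defines the apex.
\<close>

definition candidate :: "3 \<Rightarrow> (real^3) set" where
  "candidate k = {y. (\<Sum>l\<in>UNIV. coord l \<bullet> y) = (2 + 2 * apex k) * (coord k \<bullet> y)}"

text \<open>
  h supports the ball at the point given by a, so the ray leaves the ball there. In particular the
  third member of another system containing g i and g j is determined by the ball and by x.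
\<close>

lemma apex_eq:
  assumes d: "i \<noteq> j" "i \<noteq> k" "j \<noteq> k" and h: "h \<in> dual_ball N"
    and hx: "h \<bullet> x i = 1" "h \<bullet> x j = 1" "h \<bullet> x k = 1 - 2 * a"
    and a: "N (x k + a *\<^sub>R (x i + x j)) \<le> 1"
  shows "apex k = a"
proof -
  have eq: "(\<Sum>l\<in>UNIV. x l) - x k = x i + x j" by (simp add: sum_over_3[OF d])
  have "t \<le> a" if "N (x k + t *\<^sub>R (x i + x j)) \<le> 1" for t
  proof -
    have "h \<bullet> (x k + t *\<^sub>R (x i + x j)) \<le> 1"
      using dual_ball_abs[OF norm h, of "x k + t *\<^sub>R (x i + x j)"] that by linarith
    then show ?thesis by (simp add: inner_add_right hx)
  qed
  then show ?thesis unfolding apex_def eq using a by (intro cSup_eq_maximum) auto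
qed

lemma plane_eq_candidate:
  assumes d: "i \<noteq> j" "i \<noteq> k" "j \<noteq> k" and h: "h \<in> dual_ball N"
    and hx: "h \<bullet> x i = 1" "h \<bullet> x j = 1" "h \<bullet> x k = 1 - 2 * a"
    and a: "N (x k + a *\<^sub>R (x i + x j)) \<le> 1"
  shows "{y. (g i + g j + h) \<bullet> y = 0} = candidate k"
proof -
  have "(g i + g j + h) \<bullet> y = (\<Sum>l\<in>UNIV. coord l \<bullet> y) - (2 + 2 * a) * (coord k \<bullet> y)" for y
    using inner_expand[of h y] g_coord[of i j k y] g_coord[of j i k y] d
    by (simp add: sum_over_3[OF d] inner_add_left hx algebra_simps)
  then show ?thesis using apex_eq[OF assms] by (simp add: candidate_def)
qed

lemma signed_dual_ball: "h \<in> dual_ball N \<Longrightarrow> \<bar>s\<bar> = 1 \<Longrightarrow> s *\<^sub>R h \<in> dual_ball N"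
proof -
  assume h: "h \<in> dual_ball N" "\<bar>s\<bar> = 1"
  then have "s = 1 \<or> s = - 1" by linarith
  then show ?thesis
    using dual_ball_abs[OF norm h(1)] by (auto simp: dual_ball_def abs_le_iff)
qed

text \<open>
  Let another extremal system be given. The contact set of each g' l contains the points
  (g' l (x' m)) x' m for all m. No two of the g' l can each touch the ball in only one octant
  of constant sign: they share one of these points, while another point of one contact set is the
  negative of a point of the other. By the trichotomy at least two of the g' l are therefore of the form \<plusminus>g i and \<plusminus>g j. If their signs agree,
  the third is either \<plusminus>g k, which gives the plane of the given system or a candidate, or touches
  the ball in one octant only and is then the functional in the definition of the candidate. If
  the signs differ, the third must be \<plusminus>g k, the ball is the whole parallelepiped, and the plane is
  again a candidate.
\<close>

lemma plane_of_other_system: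
  assumes other: "extremal_system N x' g'"
  shows "{y. (\<Sum>l\<in>UNIV. g' l) \<bullet> y = 0} \<in> insert {y. (\<Sum>l\<in>UNIV. g l) \<bullet> y = 0} (range candidate)"
proof -
  interpret S: extremal_system N x' g' by (rule other)
  have contact: "N ((g' l \<bullet> x' m) *\<^sub>R x' m) \<le> 1 \<and> g' l \<bullet> ((g' l \<bullet> x' m) *\<^sub>R x' m) = 1" for l m
    using S.ball[of m] by (simp add: S.pairing is_norm_scaleR[OF norm] is_norm_minus[OF norm])
  have nondeg: "\<exists>y. N y \<le> 1 \<and> g' l \<bullet> y = 1 \<and> coord k \<bullet> y \<noteq> 0" for k l
  proof (rule ccontr)
    assume none: "\<not> ?thesis"
    have "coord k \<bullet> x' m = 0 \<bullet> x' m" for m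
    proof -
      have "coord k \<bullet> ((g' l \<bullet> x' m) *\<^sub>R x' m) = 0" using none contact by blast
      then show ?thesis by (simp add: S.pairing split: if_splits)
    qed
    then have "coord k = 0" by (rule S.functional_eqI)
    then show False using coord_x[of k k] by simp
  qed
  define facet where "facet l \<longleftrightarrow> (\<exists>k s. \<bar>s\<bar> = 1 \<and> g' l = s *\<^sub>R g k)" for l
  define signed where "signed h s \<longleftrightarrow> (\<forall>y. N y \<le> 1 \<and> h \<bullet> y = 1 \<longrightarrow> (\<forall>k. 0 \<le> s * (coord k \<bullet> y)))" for h and s :: real
  have alt: "facet l \<or> (\<exists>s. \<bar>s\<bar> = 1 \<and> signed (g' l) s)" for l
    unfolding facet_def signed_def by (rule contact_trichotomy[OF S.dual nondeg])
  \<comment> \<open>t is 1 for a shared contact point and -1 for one that occurs with both signs.\<close>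
  have opposite: False if s: "signed h s" "signed h' s'" "\<bar>s\<bar> = 1" "\<bar>s'\<bar> = 1"
    and y: "N y \<le> 1" "h \<bullet> y = 1" "N (t *\<^sub>R y) \<le> 1" "h' \<bullet> (t *\<^sub>R y) = 1" "s * s' * t < 0" for h h' s s' t y
  proof -
    have "coord k \<bullet> y = 0" for k
    proof -
      have "0 \<le> s * (coord k \<bullet> y)" "0 \<le> s' * (coord k \<bullet> (t *\<^sub>R y))" using s y unfolding signed_def by blast+
      moreover have "s = 1 \<or> s = - 1" "s' = 1 \<or> s' = - 1" using s by linarith+
      ultimately show ?thesis using y(5)
        by (auto simp: zero_le_mult_iff mult_le_0_iff)
    qed
    then have "y = 0" by (intro vector_eqI) simp
    then show False using y by simp
  qed
  have pm: "s = 1 \<or> s = - 1" if "\<bar>s\<bar> = 1" for s :: real using that by linarith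
  have two: "facet l \<or> facet m" if lm: "l \<noteq> m" for l m
  proof (rule ccontr)
    assume "\<not> ?thesis"
    then obtain s s' where s: "\<bar>s\<bar> = 1" "signed (g' l) s" "\<bar>s'\<bar> = 1" "signed (g' m) s'" using alt by blast
    obtain n where n: "l \<noteq> n" "m \<noteq> n" using lm by (rule third_index)
    have "s * s' * 1 < 0 \<or> s * s' * (- 1) < 0" using s pm[of s] pm[of s'] by auto
    then show False
    proof
      assume "s * s' * 1 < 0"
      then show False
        using opposite[OF s(2,4,1,3), of "- x' n" 1] S.ball[of n] n
        by (simp add: S.pairing is_norm_minus[OF norm])
    next
      assume "s * s' * (- 1) < 0"
      then show False
        using opposite[OF s(2,4,1,3), of "x' l" "- 1"] S.ball[of l] lm
        by (simp add: S.pairing is_norm_minus[OF norm])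
    qed
  qed
  obtain l m where lm: "l \<noteq> m" "facet l" "facet m"
  proof -
    have "facet 1 \<and> facet 2 \<or> facet 1 \<and> facet 3 \<or> facet 2 \<and> facet 3"
      using two[of 1 2] two[of 1 3] two[of 2 3] by auto
    then show ?thesis using that[of 1 2] that[of 1 3] that[of 2 3] by auto
  qed
  then obtain n where n: "l \<noteq> n" "m \<noteq> n" using third_index by blast
  obtain i s where s: "\<bar>s\<bar> = 1" "g' l = s *\<^sub>R g i" using lm(2) facet_def by blast
  obtain j s' where s': "\<bar>s'\<bar> = 1" "g' m = s' *\<^sub>R g j" using lm(3) facet_def by blast
  have ss: "s * s = 1" "s' * s' = 1" using pm[OF s(1)] pm[OF s'(1)] by auto
  have gi: "g i = s *\<^sub>R g' l" and gj: "g j = s' *\<^sub>R g' m" using s s' ss by simp_all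
  \<comment> \<open>Normalising by s turns the coefficient of g i into 1.\<close>
  define h where "h = s *\<^sub>R g' n"
  have hB: "h \<in> dual_ball N" unfolding h_def by (rule signed_dual_ball[OF S.dual s(1)])
  have g'n: "g' n = s *\<^sub>R h" using ss by (simp add: h_def)
  have indep: "s1 *\<^sub>R g' p \<noteq> s2 *\<^sub>R g' q" if pq: "p \<noteq> q" "\<bar>s1\<bar> = 1" "\<bar>s2\<bar> = 1" for p q s1 s2
  proof
    assume eq: "s1 *\<^sub>R g' p = s2 *\<^sub>R g' q"
    obtain r where r: "p \<noteq> r" "q \<noteq> r" using third_index[OF pq(1)] by blast
    have "s1 = - s2" using arg_cong[OF eq, of "\<lambda>v. v \<bullet> x' p"] that by (simp add: S.pairing)
    moreover have "s1 = s2" using arg_cong[OF eq, of "\<lambda>v. v \<bullet> x' r"] r by (simp add: S.pairing)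
    ultimately show False using that by simp
  qed
  have ij: "i \<noteq> j" using indep[OF lm(1) s(1) s'(1)] gi gj by auto
  then obtain k where k: "i \<noteq> k" "j \<noteq> k" by (rule third_index)
  note d = ij k
  have sum_g': "(\<Sum>l\<in>UNIV. g' l) = s *\<^sub>R g i + s' *\<^sub>R g j + s *\<^sub>R h"
    using sum_over_3[OF lm(1) n, of g'] by (simp add: s s' g'n)
  have h_cases: "h = g k \<or> h = - g k \<or> (\<exists>t. \<bar>t\<bar> = 1 \<and> signed h t)"
  proof (cases "facet n")
    case True
    then obtain r t where t: "\<bar>t\<bar> = 1" "g' n = t *\<^sub>R g r" unfolding facet_def by blast
    have "r \<noteq> i"
    proof
      assume "r = i"
      then have "1 *\<^sub>R g' n = (t * s) *\<^sub>R g' l" using t(2) gi by simp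
      then show False using indep[of n l 1 "t * s"] n t(1) s(1) by (simp add: abs_mult)
    qed
    moreover have "r \<noteq> j"
    proof
      assume "r = j"
      then have "1 *\<^sub>R g' n = (t * s') *\<^sub>R g' m" using t(2) gj by simp
      then show False using indep[of n m 1 "t * s'"] n t(1) s'(1) by (simp add: abs_mult)
    qed
    ultimately have "r = k" using UNIV_3_eq[OF d, of r] by blast
    then show ?thesis using t pm[OF t(1)] pm[OF s(1)] by (auto simp: h_def)
  next
    case False
    then obtain t where t: "\<bar>t\<bar> = 1" "signed (g' n) t" using alt by blast
    have "signed h (s * t)"
      unfolding signed_def
    proof (intro allI impI)
      fix y q assume y: "N y \<le> 1 \<and> h \<bullet> y = 1"
      then have "N (s *\<^sub>R y) \<le> 1 \<and> g' n \<bullet> (s *\<^sub>R y) = 1"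
        using s by (simp add: h_def is_norm_scaleR[OF norm])
      then have "0 \<le> t * (coord q \<bullet> (s *\<^sub>R y))" using t(2) unfolding signed_def by blast
      then show "0 \<le> s * t * (coord q \<bullet> y)" by (simp add: mult_ac)
    qed
    then show ?thesis using s t by (auto simp: abs_mult intro!: exI[of _ "s * t"])
  qed
  have Nsx: "N (s *\<^sub>R x' p) \<le> 1" "N (- (s *\<^sub>R x' p)) \<le> 1" for p
    using S.ball[of p] s by (simp_all add: is_norm_scaleR[OF norm] is_norm_minus[OF norm])
  consider (same) "s' = s" | (opp) "s' = - s" using pm[OF s(1)] pm[OF s'(1)] by auto
  then show ?thesis
  proof cases
    case same
    define z p q where "z = s *\<^sub>R x' n" and "p = - (s *\<^sub>R x' l)" and "q = - (s *\<^sub>R x' m)"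
    have gz: "g i \<bullet> z = - 1" "g j \<bullet> z = - 1" "h \<bullet> z = 1"
      and gp: "g i \<bullet> p = - 1" "g j \<bullet> p = 1" "h \<bullet> p = 1"
      and gq: "g i \<bullet> q = 1" "g j \<bullet> q = - 1" "h \<bullet> q = 1"
      using lm(1) n ss same unfolding gi gj h_def z_def p_def q_def
      by (simp_all add: S.pairing)
    have NB: "N z \<le> 1" "N p \<le> 1" "N q \<le> 1" using Nsx by (simp_all add: z_def p_def q_def)
    define a where "a = coord i \<bullet> z"
    have cz: "coord k \<bullet> z = 1" "coord j \<bullet> z = a" "coord i \<bullet> z = a"
      using gz g_coord[of i j k z] g_coord[of j i k z] d by (auto simp: a_def)
    have z_eq: "z = x k + a *\<^sub>R (x i + x j)"
      by (rule trans[OF expand]) (simp add: sum_over_3[OF d] cz algebra_simps)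
    have plane: "(\<Sum>l\<in>UNIV. g' l) \<bullet> y = 0 \<longleftrightarrow> (g i + g j + h) \<bullet> y = 0" for y
    proof -
      have "(\<Sum>l\<in>UNIV. g' l) = s *\<^sub>R (g i + g j + h)"
        by (simp add: sum_g' same algebra_simps)
      then show ?thesis using s(1) by auto
    qed
    show ?thesis
    proof (cases "h = g k")
      case True
      then show ?thesis using plane by (simp add: sum_over_3[OF d, of g])
    next
      case False
      have "h \<bullet> x i = 1 \<and> h \<bullet> x j = 1 \<and> h \<bullet> x k = 1 - 2 * a"
      proof (cases "h = - g k")
        case True
        have "g k \<bullet> z = - 1" using gz(3) True by simp
        then have "a = 1" using g_coord[of k i j z] d cz by auto
        then show ?thesis using True d by (auto simp: pairing)
      next
        case False
        then obtain t where t: "\<bar>t\<bar> = 1" "signed h t" using h_cases \<open>h \<noteq> g k\<close> by blast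
        have "0 \<le> t * (coord k \<bullet> z)" using t(2) NB gz unfolding signed_def by blast
        then have "t = 1" using pm[OF t(1)] cz by auto
        then have nn: "0 \<le> coord r \<bullet> p" "0 \<le> coord r \<bullet> q" for r
          using t(2) NB gp gq unfolding signed_def by (metis mult_1)+
        \<comment> \<open>Nonnegativity and the bound on g k leave only p = x j and q = x i.\<close>
        have cp: "coord k \<bullet> p = 0" "coord j \<bullet> p = 1" "coord i \<bullet> p = 0"
          using gp nn(1)[of i] nn(1)[of j] g_coord[of i j k p] g_coord[of j i k p] g_coord[of k i j p] d
            abs_g_le[OF NB(2), of k] by (auto simp: abs_le_iff)
        have cq: "coord k \<bullet> q = 0" "coord i \<bullet> q = 1" "coord j \<bullet> q = 0"
          using gq nn(2)[of i] nn(2)[of j] g_coord[of i j k q] g_coord[of j i k q] g_coord[of k i j q] d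
            abs_g_le[OF NB(3), of k] by (auto simp: abs_le_iff)
        have "h \<bullet> x j = 1" "h \<bullet> x i = 1"
          using gp(3) gq(3) inner_expand[of h p] inner_expand[of h q] by (simp_all add: sum_over_3[OF d] cp cq)
        then show ?thesis using gz(3) inner_expand[of h z] by (simp add: sum_over_3[OF d] cz)
      qed
      then have "{y. (g i + g j + h) \<bullet> y = 0} = candidate k"
        using plane_eq_candidate[OF d hB] NB(1) z_eq by simp
      then show ?thesis using plane by simp
    qed
  next
    case opp
    define z w where "z = - (s *\<^sub>R x' l)" and "w = - (s *\<^sub>R x' m)"
    have gz: "g i \<bullet> z = - 1" "g j \<bullet> z = - 1" "h \<bullet> z = 1"
      and gw: "g i \<bullet> w = 1" "g j \<bullet> w = 1" "h \<bullet> w = 1"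
      using lm(1) n ss opp unfolding gi gj h_def z_def w_def
      by (simp_all add: S.pairing)
    have NB: "N z \<le> 1" "N w \<le> 1" using Nsx by (simp_all add: z_def w_def)
    have cz: "coord k \<bullet> z = 1" and cw: "coord k \<bullet> w = - 1"
      using gz gw g_coord[of i j k z] g_coord[of j i k z] g_coord[of i j k w] g_coord[of j i k w] d by auto
    have "\<not> signed h t" if "\<bar>t\<bar> = 1" for t
    proof
      assume "signed h t"
      then have "0 \<le> t * (coord k \<bullet> z)" "0 \<le> t * (coord k \<bullet> w)" using NB gz gw unfolding signed_def by blast+
      then show False using that cz cw by simp
    qed
    then have hk: "h = g k \<or> h = - g k" using h_cases by blast
    \<comment> \<open>Either way the point x i + x j + x k lies in the unit ball.\<close>
    have top: "N (x i + x j + x k) \<le> 1"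
    proof -
      obtain v where v: "N v \<le> 1" "\<And>r. g r \<bullet> v = - 1"
      proof (cases "h = g k")
        case True
        have "N (- w) \<le> 1" using NB by (simp add: is_norm_minus[OF norm])
        moreover have "g r \<bullet> (- w) = - 1" for r
          using UNIV_3_eq[OF d, of r] gw True by auto
        ultimately show ?thesis using that by blast
      next
        case False
        then have "g r \<bullet> z = - 1" for r
          using UNIV_3_eq[OF d, of r] gz hk by auto
        then show ?thesis using that NB by blast
      qed
      have "coord r \<bullet> v = 1" for r by (simp add: coord_def inner_diff_left inner_sum_left v)
      then have "v = x i + x j + x k" 
        by (subst expand) (simp add: sum_over_3[OF d])
      then show ?thesis using v by simp
    qed
    have cand: "{y. (g a + g b - g c) \<bullet> y = 0} = candidate c" if "a \<noteq> b" "a \<noteq> c" "b \<noteq> c" for a b c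
    proof -
      have "x c + 1 *\<^sub>R (x a + x b) = x i + x j + x k"
        using sum_over_3[OF that, of x] sum_over_3[OF d, of x] by (simp add: algebra_simps)
      then show ?thesis
        using plane_eq_candidate[OF that, of "- g c" 1] signed_dual_ball[OF dual, of "- 1" c] top that
        by (simp add: pairing)
    qed
    from hk show ?thesis
    proof
      assume "h = g k"
      then have "(\<Sum>l\<in>UNIV. g' l) = s *\<^sub>R (g i + g k - g j)"
        by (simp add: sum_g' opp algebra_simps)
      then have "{y. (\<Sum>l\<in>UNIV. g' l) \<bullet> y = 0} = {y. (g i + g k - g j) \<bullet> y = 0}"
        using s(1) by auto
      then show ?thesis using cand[of i k j] d by simp
    next
      assume "h = - g k"
      then have "(\<Sum>l\<in>UNIV. g' l) = (- s) *\<^sub>R (g j + g k - g i)"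
        by (simp add: sum_g' opp algebra_simps)
      then have "{y. (\<Sum>l\<in>UNIV. g' l) \<bullet> y = 0} = {y. (g j + g k - g i) \<bullet> y = 0}"
        using s(1) by auto
      then show ?thesis using cand[of j k i] d by simp
    qed
  qed
qed

end

section \<open>At most four planes\<close>

text \<open>
  One plane fixes an extremal system; every other plane comes from a system of its own and is thus
  the plane of the fixed system or one of its three candidates.
\<close>

lemma extremal_planes_finite:
  fixes N :: "real^3 \<Rightarrow> real"
  assumes N: "is_norm N"
    and \<Y>: "\<And>Y. Y \<in> \<Y> \<Longrightarrow> subspace Y \<and> dim Y = 2 \<and> no_good_projection N Y"
  shows "finite \<Y> \<and> card \<Y> \<le> 4"
proof (cases "\<Y> = {}")
  case False
  then obtain Y0 where "Y0 \<in> \<Y>" by blast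
  then obtain x g where sys: "extremal_system N x g"
    using extremal_system_exists[OF N] \<Y> by metis
  interpret S: extremal_system N x g by (rule sys)
  let ?C = "insert {y. (\<Sum>l\<in>UNIV. g l) \<bullet> y = 0} (range S.candidate)"
  have "\<Y> \<subseteq> ?C"
  proof
    fix Y assume "Y \<in> \<Y>"
    then obtain x' g' where "extremal_system N x' g'" "Y = {y. (\<Sum>i\<in>UNIV. g' i) \<bullet> y = 0}"
      using extremal_system_exists[OF N] \<Y> by metis
    then show "Y \<in> ?C" using S.plane_of_other_system by metis
  qed
  moreover have "card (range S.candidate) \<le> 3"
    using card_image_le[of "UNIV :: 3 set" S.candidate] by simp
  then have "card ?C \<le> 4"
    using card_insert_le_m1[of 4 "range S.candidate"] by simp
  moreover have "finite ?C" by simp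
  ultimately show ?thesis by (meson card_mono finite_subset order_trans)
qed simp

text \<open>
  The dimension of a real vector space without a finite basis is 0 by convention, so dimension 3
  provides a basis of three vectors.
\<close>

lemma coordinates_exist:
  assumes "dim (UNIV :: 'a::real_vector set) = 3"
  obtains \<phi> :: "real^3 \<Rightarrow> 'a::real_vector" and \<psi> where "linear \<phi>" "linear \<psi>"
    "\<And>v. \<psi> (\<phi> v) = v" "\<And>y. \<phi> (\<psi> y) = y"
proof -
  obtain B :: "'a set" where B: "independent B" "UNIV \<subseteq> span B" "card B = 3"
    using real_vector.basis_exists[of "UNIV :: 'a set"] assms by metis
  obtain b1 b2 b3 where b: "B = {b1, b2, b3}" "b1 \<noteq> b2" "b1 \<noteq> b3" "b2 \<noteq> b3"
    using B(3) by (auto simp: card_3_iff)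
  define \<phi> where "\<phi> v = v $ 1 *\<^sub>R b1 + v $ 2 *\<^sub>R b2 + v $ 3 *\<^sub>R b3" for v :: "real^3"
  have lin: "linear \<phi>"
    unfolding \<phi>_def by (intro linearI) (auto simp: algebra_simps)
  have inj: "inj \<phi>"
  proof (rule linear_injective_0[OF lin, THEN iffD2], intro allI impI)
    fix v assume "\<phi> v = 0"
    define u where "u = (\<lambda>b. if b = b1 then v $ 1 else if b = b2 then v $ 2 else v $ 3)"
    have "(\<Sum>b\<in>B. u b *\<^sub>R b) = 0"
      using \<open>\<phi> v = 0\<close> b by (simp add: \<phi>_def u_def add.assoc)
    then have "\<forall>b\<in>B. u b = 0"
      using B(1) real_vector.dependent_finite[of B] b(1) by auto
    then show "v = 0" using b by (auto simp: u_def vec_eq_iff forall_3)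
  qed
  have "\<exists>v. \<phi> v = y" for y
  proof -
    have "y \<in> range (\<lambda>u. \<Sum>b\<in>B. u b *\<^sub>R b)"
      using B(2) real_vector.span_finite[of B] b(1) by auto
    then obtain u where "y = (\<Sum>b\<in>B. u b *\<^sub>R b)" by blast
    then have "\<phi> (vector [u b1, u b2, u b3]) = y"
      using b by (simp add: \<phi>_def add.assoc)
    then show ?thesis by blast
  qed
  then have inv: "\<phi> (inv \<phi> y) = y" for y by (metis someI_ex inv_def surj_def surj_f_inv_f)
  have "linear (inv \<phi>)"
    by (intro linearI; rule injD[OF inj]) (simp_all add: inv linear_add[OF lin] linear_scale[OF lin])
  then show ?thesis using that[of \<phi> "inv \<phi>"] lin inv inj by simp
qed

lemma planes_43_finite:
  fixes N :: "'a::real_vector \<Rightarrow> real"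
  assumes dim: "dim (UNIV :: 'a set) = 3" and N: "is_norm N"
  shows "finite (planes_43 N) \<and> card (planes_43 N) \<le> 4"
proof -
  obtain \<phi> :: "real^3 \<Rightarrow> 'a" and \<psi> where lin: "linear \<phi>" "linear \<psi>"
    and inv: "\<And>v. \<psi> (\<phi> v) = v" "\<And>y. \<phi> (\<psi> y) = y"
    by (rule coordinates_exist[OF dim], rule that)
  define M where "M v = N (\<phi> v)" for v
  have "\<phi> v = 0 \<longleftrightarrow> v = 0" for v by (metis inv(1) lin linear_0)
  then have M: "is_norm M"
    using N by (simp add: is_norm_def M_def linear_add[OF lin(1)] linear_scale[OF lin(1)])
  have inj\<psi>: "inj \<psi>" by (metis injI inv(2))
  have transfer: "subspace (\<psi> ` Y) \<and> dim (\<psi> ` Y) = 2 \<and> no_good_projection M (\<psi> ` Y)"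
    if Y: "Y \<in> planes_43 N" for Y
  proof (intro conjI)
    have sub: "subspace Y" and dimY: "dim Y = 2" using Y by (auto simp: planes_43_def)
    show "subspace (\<psi> ` Y)" by (rule linear_subspace_image[OF lin(2) sub])
    obtain B where B: "B \<subseteq> Y" "independent B" "Y \<subseteq> span B" "card B = 2"
      using real_vector.basis_exists[of Y] dimY by metis
    show "dim (\<psi> ` Y) = 2"
    proof (rule dim_unique)
      show "\<psi> ` B \<subseteq> \<psi> ` Y" using B by blast
      show "\<psi> ` Y \<subseteq> span (\<psi> ` B)" using B(3) linear_span_image[OF lin(2)] by blast
      show "independent (\<psi> ` B)"
        using linear_independent_injective_image[OF lin(2) B(2)] inj\<psi> inj_on_subset by blast
      show "card (\<psi> ` B) = 2" using B(4) inj\<psi> by (metis card_image inj_on_subset subset_UNIV)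
    qed
    show "no_good_projection M (\<psi> ` Y)"
      unfolding no_good_projection_def
    proof (intro allI impI)
      fix P K
      assume P: "linear P" "range P \<subseteq> \<psi> ` Y" "\<forall>y\<in>\<psi> ` Y. P y = y" "\<forall>v. M (P v) \<le> K * M v"
      let ?Q = "\<lambda>y. \<phi> (P (\<psi> y))"
      have "linear ?Q" 
        using linear_compose[OF linear_compose[OF lin(2) P(1)] lin(1)] by (simp add: o_def)
      moreover have "range ?Q \<subseteq> Y"
      proof safe
        fix y
        obtain z where "z \<in> Y" "P (\<psi> y) = \<psi> z" using P(2) by blast
        then show "?Q y \<in> Y" by (simp add: inv)
      qed
      moreover have "\<forall>y\<in>Y. ?Q y = y" using P(3) by (simp add: inv)
      moreover have "\<forall>y. N (?Q y) \<le> K * N y" using P(4) by (metis M_def inv(2))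
      ultimately show "4 / 3 \<le> K"
        using planes_43_no_good_projection[OF N Y] unfolding no_good_projection_def by blast
    qed
  qed
  have "finite ((`) \<psi> ` planes_43 N) \<and> card ((`) \<psi> ` planes_43 N) \<le> 4"
    by (rule extremal_planes_finite[OF M]) (use transfer in blast)
  moreover have "inj_on ((`) \<psi>) (planes_43 N)"
    by (rule inj_onI) (simp add: inj_image_eq_iff[OF inj\<psi>])
  ultimately show ?thesis by (metis card_image finite_imageD)
qed

section \<open>A space with four planes\<close>

definition l1_norm :: "real^'n \<Rightarrow> real" where
  "l1_norm x = (\<Sum>i\<in>UNIV. \<bar>x $ i\<bar>)"

lemma is_norm_l1: "is_norm l1_norm"
  unfolding is_norm_def l1_norm_def
  by (auto simp: sum_nonneg sum_nonneg_eq_0_iff vec_eq_iff abs_mult sum_distrib_left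
      simp flip: sum.distrib intro!: sum_mono)

text \<open>
  The projection along s has norm at most 4/3 by the triangle inequality. For any projection
  y - (s \<bullet> y) w, the norms of the images of the three unit vectors add up to at least 4, so one of
  them is at least 4/3.
\<close>

lemma l1_plane:
  fixes s :: "real^3"
  assumes s: "\<And>i. \<bar>s $ i\<bar> = 1"
  shows "{y. s \<bullet> y = 0} \<in> planes_43 l1_norm"
proof -
  let ?Y = "{y. s \<bullet> y = 0}"
  have ss: "s $ i * s $ i = 1" for i using s[of i] by (metis abs_mult_self_eq mult_1)
  have sne: "s \<noteq> 0" using s[of 1] by auto
  have inner_s: "s \<bullet> y = s $ 1 * y $ 1 + s $ 2 * y $ 2 + s $ 3 * y $ 3" for y
    by (simp add: inner_vec_def sum_3)
  have s_s: "s \<bullet> s = 3" using ss by (simp add: inner_s)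
  define P where "P y = y - ((s \<bullet> y) / 3) *\<^sub>R s" for y
  have P: "linear P" "range P \<subseteq> ?Y" "\<And>y. y \<in> ?Y \<Longrightarrow> P y = y"
    unfolding P_def by (auto intro!: linearI simp: inner_add_right inner_diff_right s_s algebra_simps add_divide_distrib)
  have PK: "l1_norm (P y) \<le> 4 / 3 * l1_norm y" for y
  proof -
    have "\<bar>P y $ i\<bar> \<le> 2 / 3 * \<bar>y $ i\<bar> + \<bar>y $ j\<bar> / 3 + \<bar>y $ k\<bar> / 3"
      if "i \<noteq> j" "i \<noteq> k" "j \<noteq> k" for i j k
    proof -
      have "s \<bullet> y = s $ i * y $ i + s $ j * y $ j + s $ k * y $ k"
        using sum_over_3[OF that, of "\<lambda>i. s $ i * y $ i"] by (simp add: inner_vec_def)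
      then have "P y $ i = 2 / 3 * y $ i - (s $ i * s $ j * y $ j) / 3 - (s $ i * s $ k * y $ k) / 3"
        using ss[of i] by (simp add: P_def algebra_simps)
      moreover have "\<bar>s $ i * s $ j * y $ j\<bar> = \<bar>y $ j\<bar>" "\<bar>s $ i * s $ k * y $ k\<bar> = \<bar>y $ k\<bar>"
        by (simp_all add: abs_mult s)
      ultimately show ?thesis by linarith
    qed
    from this[of 1 2 3] this[of 2 1 3] this[of 3 1 2] show ?thesis
      by (simp add: l1_norm_def sum_3)
  qed
  have lower: "4 / 3 \<le> onorm_wrt l1_norm Q" if Q: "projection_onto l1_norm ?Y Q" for Q
  proof -
    have lin: "linear Q" and Qb: "bounded_linear_wrt l1_norm Q"
      using Q by (auto simp: projection_onto_def bounded_linear_wrt_def)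
    \<comment> \<open>The unit vector times s $ 1 is mapped to 1 by s, so w spans the kernel of Q.\<close>
    define w where "w = s $ 1 *\<^sub>R (axis 1 1 - Q (axis 1 1))"
    have sw: "s \<bullet> w = 1"
    proof -
      have "Q (axis 1 1) \<in> ?Y" using Q by (auto simp: projection_onto_def)
      then show ?thesis by (simp add: w_def inner_diff_right inner_axis ss)
    qed
    have Q_eq: "Q y = y - (s \<bullet> y) *\<^sub>R w" for y
    proof -
      define z where "z = y - (s \<bullet> y) *\<^sub>R (s $ 1 *\<^sub>R axis 1 1)"
      have "z \<in> ?Y" by (simp add: z_def inner_diff_right inner_axis ss)
      then have "Q z = z" using Q by (auto simp: projection_onto_def)
      moreover have "Q z = Q y - (s \<bullet> y) *\<^sub>R (s $ 1 *\<^sub>R Q (axis 1 1))"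
        by (simp add: z_def linear_diff[OF lin] linear_scale[OF lin])
      ultimately have "Q y = z + (s \<bullet> y) *\<^sub>R (s $ 1 *\<^sub>R Q (axis 1 1))" by (metis diff_add_cancel)
      then show ?thesis by (simp add: z_def w_def scaleR_diff_right)
    qed
    \<comment> \<open>Testing on the unit vectors; the three lower bounds add up to 4.\<close>
    have col: "1 + s \<bullet> w - 2 * (s $ i * w $ i) \<le> onorm_wrt l1_norm Q" for i
    proof -
      obtain j where ij: "i \<noteq> j" by (metis zero_neq_one)
      then obtain k where k: "i \<noteq> k" "j \<noteq> k" by (rule third_index)
      note neq = ij ij[symmetric] k k[symmetric]
      have "l1_norm (axis i 1 :: real^3) = 1"
        by (simp add: l1_norm_def sum_over_3[OF ij k] axis_def neq)
      then have "l1_norm (Q (axis i 1)) \<le> onorm_wrt l1_norm Q"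
        using onorm_wrt_ge[OF is_norm_l1 Qb, of "axis i 1"] by simp
      moreover have Q_i: "Q (axis i 1) = axis i 1 - s $ i *\<^sub>R w" by (simp add: Q_eq inner_axis)
      moreover have "l1_norm (Q (axis i 1)) = \<bar>1 - s $ i * w $ i\<bar> + \<bar>w $ j\<bar> + \<bar>w $ k\<bar>"
        unfolding Q_i by (simp add: l1_norm_def sum_over_3[OF ij k] axis_def abs_mult s neq)
      moreover have "s $ j * w $ j \<le> \<bar>w $ j\<bar>" "s $ k * w $ k \<le> \<bar>w $ k\<bar>"
        using abs_ge_self[of "s $ j * w $ j"] abs_ge_self[of "s $ k * w $ k"] by (simp_all add: abs_mult s)
      moreover have "s \<bullet> w = s $ i * w $ i + s $ j * w $ j + s $ k * w $ k"
        using sum_over_3[OF ij k, of "\<lambda>i. s $ i * w $ i"] by (simp add: inner_vec_def)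
      ultimately show ?thesis by linarith
    qed
    from col[of 1] col[of 2] col[of 3] show ?thesis
      using inner_s[of w] by (simp add: sw)
  qed
  have "rel_proj_const l1_norm ?Y = 4 / 3"
  proof (rule antisym)
    show "rel_proj_const l1_norm ?Y \<le> 4 / 3"
      by (rule rel_proj_const_le[OF is_norm_l1 P _ PK]) simp_all
    have "projection_onto l1_norm ?Y P"
      using P PK unfolding projection_onto_def bounded_linear_wrt_def by (metis mult.commute)
    then show "4 / 3 \<le> rel_proj_const l1_norm ?Y"
      unfolding rel_proj_const_def using lower by (intro cINF_greatest) auto
  qed
  moreover have "subspace ?Y" by (rule subspace_hyperplane)
  moreover have "dim ?Y = 2" using dim_hyperplane[OF sne] by simp
  ultimately show ?thesis by (simp add: planes_43_def)
qed

lemma card_planes_43_l1: "finite (planes_43 (l1_norm :: real^3 \<Rightarrow> real)) \<and> card (planes_43 (l1_norm :: real^3 \<Rightarrow> real)) = 4"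
proof -
  define F where "F = (\<lambda>(p, q). {y :: real^3. vector [1, p, q] \<bullet> y = 0})"
  let ?S = "{1, - 1} \<times> {1, - 1 :: real}"
  have "F ` ?S \<subseteq> planes_43 l1_norm"
  proof
    fix Y assume "Y \<in> F ` ?S"
    then obtain p q where "(p, q) \<in> ?S" "Y = F (p, q)" by blast
    then have pq: "\<bar>p\<bar> = 1" "\<bar>q\<bar> = 1" "Y = {y. vector [1, p, q] \<bullet> y = 0}"
      by (auto simp: F_def)
    have "\<bar>(vector [1, p, q] :: real^3) $ i\<bar> = 1" for i
      using exhaust_3[of i] pq by auto
    then show "Y \<in> planes_43 l1_norm" unfolding pq(3) by (rule l1_plane)
  qed
  moreover have "inj_on F ?S"
  proof (rule inj_onI, clarify)
    fix p q p' q' :: real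
    assume pq: "p \<in> {1, - 1}" "q \<in> {1, - 1}" "p' \<in> {1, - 1}" "q' \<in> {1, - 1}" and eq: "F (p, q) = F (p', q')"
    \<comment> \<open>These two vectors of the plane determine p and q, since p and q are their own inverses.\<close>
    have "vector [1, - p, 0] \<in> F (p, q)" "vector [1, 0, - q] \<in> F (p, q)"
      using pq by (auto simp: F_def inner_vec_def sum_3)
    then have "vector [1, - p, 0] \<in> F (p', q')" "vector [1, 0, - q] \<in> F (p', q')"
      by (simp_all add: eq)
    then show "p = p' \<and> q = q'" using pq by (auto simp: F_def inner_vec_def sum_3)
  qed
  then have "card (F ` ?S) = 4" by (simp add: card_image card_cartesian_product)
  moreover have "finite (planes_43 (l1_norm :: real^3 \<Rightarrow> real)) \<and> card (planes_43 (l1_norm :: real^3 \<Rightarrow> real)) \<le> 4"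
    by (rule planes_43_finite) (simp_all add: is_norm_l1)
  ultimately show ?thesis by (metis card_mono le_antisym)
qed

theorem theorem3p2:
  shows "(\<forall>N :: 'a::real_vector \<Rightarrow> real. dim (UNIV :: 'a set) = 3 \<and> is_norm N \<longrightarrow>
            finite (planes_43 N) \<and> card (planes_43 N) \<le> 4)
       \<and> (\<exists>N :: real ^ 3 \<Rightarrow> real. is_norm N \<and>
            finite (planes_43 N) \<and> card (planes_43 N) = 4)"
  using planes_43_finite is_norm_l1 card_planes_43_l1 by blast

end
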